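(* Let $K$ be a field of characteristic $0$, let $X=\{x_1,x_2,\ldots\}$ be a countable set, and let $\mathcal{V}(X)$ be the free algebra generated by $X$ in the variety $\mathcal{V}$ of (nonassociative) $K$-algebras defined by the identities $$(a,b,c)+(a,c,b)=0,\qquad (a,b,c)+(b,a,c)=0,\qquad (ab)c+(cb)a=(ac)b+(ca)b,$$ where $(a,b,c)=(ab)c-a(bc)$. Define the following subsets of $\mathcal{V}(X)$: $$\mathcal{B}_1=\{x_i\},\qquad \mathcal{B}_2=\{x_ix_r\},$$ $$\mathcal{B}_3=\{(x_ix_j)x_k,\ (x_ix_k)x_j,\ (x_jx_i)x_k,\ (x_kx_i)x_j,\ x_k(x_ix_j),\ (x_jx_i)x_i,\ (x_ix_i)x_j,\ (x_ix_i)x_i\},$$ $$\mathcal{B}_4=\{((x_ix_j)x_k)x_l,\ ((x_ix_j)x_l)x_k,\ ((x_jx_i)x_k)x_l,\ ((x_kx_i)x_j)x_l,\ ((x_lx_i)x_j)x_k,\ (x_k(x_ix_j))x_l,$$ $$((x_jx_i)x_i)x_i,\ ((x_ix_i)x_i)x_j,\ ((x_jx_i)x_i)x_j,\ ((x_ix_i)x_j)x_j,\ ((x_kx_i)x_i)x_j,\ ((x_jx_i)x_i)x_k,\ ((x_ix_i)x_j)x_k\},$$ where the indices range over all $i\le j\le k\le l$ (and in $\mathcal{B}_2$ the indices $i,r$ are arbitrary), and for $n\ge 5$ $$\mathcal{B}_n=\{(\cdots((x_{i_1}x_{i_2})x_{i_3})\cdots)x_{i_n}\ :\ i_2\le i_3\le\cdots\le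 i_n\}.$$ Then the set $\bigcup_{n\ge 1}\mathcal{B}_n$ is a basis of the algebra $\mathcal{V}(X)$ as a vector space over $K$.
   Context: Algebras are not assumed associative or unital. The sets $\mathcal{B}_n$ are sets of elements of $\mathcal{V}(X)$: if for some choice of indices (for instance when some of them coincide) two of the listed expressions represent the same element of $\mathcal{V}(X)$, that element is counted once. In $\mathcal{B}_n$ with $n\ge5$ the index $i_1$ is arbitrary. *)

theory Defs
  imports Complex_Main "HOL-Library.Poly_Mapping"
begin

section \<open>Nonassociative algebras and the variety\<close>

locale nonassoc_algebra = vector_space scale
  for scale :: "'k::field \<Rightarrow> 'a::ab_group_add \<Rightarrow> 'a"
  and mult :: "'a \<Rightarrow> 'a \<Rightarrow> 'a" +
  assumes mult_add_left: "mult (a + b) c = mult a c + mult b c"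
    and mult_add_right: "mult a (b + c) = mult a b + mult a c"
    and mult_scale_left: "mult (scale r a) b = scale r (mult a b)"
    and mult_scale_right: "mult a (scale r b) = scale r (mult a b)"

definition associator :: "('a::ab_group_add \<Rightarrow> 'a \<Rightarrow> 'a) \<Rightarrow> 'a \<Rightarrow> 'a \<Rightarrow> 'a \<Rightarrow> 'a" where
  "associator mult a b c = mult (mult a b) c - mult a (mult b c)"

locale variety_algebra = nonassoc_algebra scale mult
  for scale :: "'k::field \<Rightarrow> 'a::ab_group_add \<Rightarrow> 'a"
  and mult :: "'a \<Rightarrow> 'a \<Rightarrow> 'a" +
  assumes right_alternative: "associator mult a b c + associator mult a c b = 0"
    and left_alternative: "associator mult a b c + associator mult b a c = 0"
    and third_identity:
      "mult (mult a b) c + mult (mult c b) a = mult (mult a c) b + mult (mult c a) b"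


section \<open>The absolutely free nonassociative algebra\<close>

datatype 'x magma = Var 'x | App "'x magma" "'x magma"

text \<open>Elements are finitely supported functions from nonassociative monomials to the field.\<close>

type_synonym ('x, 'k) nafree = "'x magma \<Rightarrow>\<^sub>0 'k"

definition nafree_scale :: "'k::field \<Rightarrow> ('x, 'k) nafree \<Rightarrow> ('x, 'k) nafree" where
  "nafree_scale r p = Poly_Mapping.map ((*) r) p"

definition nafree_mult :: "('x, 'k::field) nafree \<Rightarrow> ('x, 'k) nafree \<Rightarrow> ('x, 'k) nafree" where
  "nafree_mult p q =
    (\<Sum>s\<in>Poly_Mapping.keys p. \<Sum>t\<in>Poly_Mapping.keys q.
      Poly_Mapping.single (App s t) (Poly_Mapping.lookup p s * Poly_Mapping.lookup q t))"

lemma lookup_nafree_scale [simp]: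
  "Poly_Mapping.lookup (nafree_scale r p) s = r * Poly_Mapping.lookup p s"
  by (simp add: nafree_scale_def map.rep_eq when_def)

lemma lookup_nafree_mult_Var [simp]:
  "Poly_Mapping.lookup (nafree_mult p q) (Var x) = 0"
  by (simp add: nafree_mult_def lookup_sum lookup_single when_def)

lemma lookup_nafree_mult_App [simp]:
  "Poly_Mapping.lookup (nafree_mult p q) (App s t) =
    Poly_Mapping.lookup p s * Poly_Mapping.lookup q t"
proof -
  have "Poly_Mapping.lookup (nafree_mult p q) (App s t) =
     (\<Sum>s'\<in>Poly_Mapping.keys p. \<Sum>t'\<in>Poly_Mapping.keys q.
        if s' = s then (if t' = t then Poly_Mapping.lookup p s * Poly_Mapping.lookup q t else 0) else 0)"
    unfolding nafree_mult_def lookup_sum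
    by (intro sum.cong refl) (auto simp: lookup_single when_def)
  also have "\<dots> = (\<Sum>s'\<in>Poly_Mapping.keys p. if s' = s then
        (\<Sum>t'\<in>Poly_Mapping.keys q. if t' = t then Poly_Mapping.lookup p s * Poly_Mapping.lookup q t else 0) else 0)"
    by (intro sum.cong refl) auto
  also have "\<dots> = Poly_Mapping.lookup p s * Poly_Mapping.lookup q t"
    by (auto simp: sum.delta in_keys_iff)
  finally show ?thesis .
qed

lemma nafree_eqI:
  fixes p q :: "('x, 'k::field) nafree"
  assumes "\<And>x. Poly_Mapping.lookup p (Var x) = Poly_Mapping.lookup q (Var x)"
    and "\<And>s t. Poly_Mapping.lookup p (App s t) = Poly_Mapping.lookup q (App s t)"
  shows "p = q"
proof (rule poly_mapping_eqI)
  fix s show "Poly_Mapping.lookup p s = Poly_Mapping.lookup q s"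
    using assms by (cases s) auto
qed

interpretation nafree: nonassoc_algebra nafree_scale nafree_mult
  by unfold_locales (auto intro!: nafree_eqI simp: lookup_add algebra_simps)


section \<open>The free algebra of the variety\<close>

text \<open>The ideal generated by all values of the defining identities in the absolutely free
  algebra; the quotient by it is the free algebra of the variety.\<close>

inductive_set identity_ideal :: "('x, 'k::field) nafree set" where
  right_alternative:
    "associator nafree_mult a b c + associator nafree_mult a c b \<in> identity_ideal"
| left_alternative:
    "associator nafree_mult a b c + associator nafree_mult b a c \<in> identity_ideal"
| third_identity:
    "(nafree_mult (nafree_mult a b) c + nafree_mult (nafree_mult c b) a)
      - (nafree_mult (nafree_mult a c) b + nafree_mult (nafree_mult c a) b) \<in> identity_ideal"
| zero: "0 \<in> identity_ideal"
| add: "p \<in> identity_ideal \<Longrightarrow> q \<in> identity_ideal \<Longrightarrow> p + q \<in> identity_ideal"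
| scale: "p \<in> identity_ideal \<Longrightarrow> nafree_scale r p \<in> identity_ideal"
| mult_left: "p \<in> identity_ideal \<Longrightarrow> nafree_mult q p \<in> identity_ideal"
| mult_right: "p \<in> identity_ideal \<Longrightarrow> nafree_mult p q \<in> identity_ideal"

lemma identity_ideal_uminus: "p \<in> identity_ideal \<Longrightarrow> - p \<in> identity_ideal"
  using identity_ideal.scale[of p "-1"] by simp

lemma identity_ideal_diff:
  "p \<in> identity_ideal \<Longrightarrow> q \<in> identity_ideal \<Longrightarrow> p - q \<in> identity_ideal"
  using identity_ideal.add[of p "- q"] identity_ideal_uminus[of q] by simp

definition ideal_rel :: "('x, 'k::field) nafree \<Rightarrow> ('x, 'k) nafree \<Rightarrow> bool" where
  "ideal_rel p q \<longleftrightarrow> p - q \<in> identity_ideal"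

lemma ideal_rel_equivp: "equivp ideal_rel"
proof (rule equivpI)
  show "reflp ideal_rel"
    by (simp add: reflp_def ideal_rel_def identity_ideal.zero)
  show "symp ideal_rel"
    unfolding symp_def ideal_rel_def by (metis identity_ideal_uminus minus_diff_eq)
  show "transp ideal_rel"
    unfolding transp_def ideal_rel_def
    using identity_ideal.add by fastforce
qed

quotient_type (overloaded) ('x, 'k) free_alg = "('x, 'k::field) nafree" / ideal_rel
  by (rule ideal_rel_equivp)

instantiation free_alg :: (type, field) ab_group_add
begin

lift_definition zero_free_alg :: "('a, 'b) free_alg" is 0 .

lift_definition plus_free_alg :: "('a, 'b) free_alg \<Rightarrow> ('a, 'b) free_alg \<Rightarrow> ('a, 'b) free_alg"
  is "(+)"
  unfolding ideal_rel_def add_diff_add by (rule identity_ideal.add)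

lift_definition uminus_free_alg :: "('a, 'b) free_alg \<Rightarrow> ('a, 'b) free_alg" is uminus
  unfolding ideal_rel_def minus_diff_minus by (rule identity_ideal_uminus)

lift_definition minus_free_alg :: "('a, 'b) free_alg \<Rightarrow> ('a, 'b) free_alg \<Rightarrow> ('a, 'b) free_alg"
  is "(-)"
proof -
  fix p p' q q' :: "('a, 'b) nafree"
  assume "ideal_rel p p'" "ideal_rel q q'"
  moreover have "(p - q) - (p' - q') = (p - p') - (q - q')"
    by (simp add: algebra_simps)
  ultimately show "ideal_rel (p - q) (p' - q')"
    unfolding ideal_rel_def by (metis identity_ideal_diff)
qed

instance
  by standard (transfer, simp add: ideal_rel_def identity_ideal.zero algebra_simps)+

end

text \<open>The class \<open>times\<close> is purely syntactic: the product is not assumed to be associative.\<close>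

instantiation free_alg :: (type, field) times
begin

lift_definition times_free_alg :: "('a, 'b) free_alg \<Rightarrow> ('a, 'b) free_alg \<Rightarrow> ('a, 'b) free_alg"
  is nafree_mult
proof -
  fix p p' q q' :: "('a, 'b) nafree"
  assume "ideal_rel p p'" "ideal_rel q q'"
  then have "nafree_mult (p - p') q + nafree_mult p' (q - q') \<in> identity_ideal"
    unfolding ideal_rel_def by (intro identity_ideal.add identity_ideal.mult_left
        identity_ideal.mult_right)
  moreover have "nafree_mult (p - p') q + nafree_mult p' (q - q')
      = nafree_mult p q - nafree_mult p' q'"
    by (rule nafree_eqI) (auto simp: lookup_add lookup_minus algebra_simps)
  ultimately show "ideal_rel (nafree_mult p q) (nafree_mult p' q')"
    by (simp add: ideal_rel_def)
qed

instance ..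

end

lift_definition scale_free_alg :: "'k::field \<Rightarrow> ('x, 'k) free_alg \<Rightarrow> ('x, 'k) free_alg"
  is nafree_scale
  unfolding ideal_rel_def
  by (metis identity_ideal.scale nafree.scale_right_diff_distrib)

lift_definition gen :: "'x \<Rightarrow> ('x, 'k::field) free_alg"
  is "\<lambda>x. Poly_Mapping.single (Var x) 1" .

lemma ideal_rel_refl: "ideal_rel p p"
  by (simp add: ideal_rel_def identity_ideal.zero)

global_interpretation free_alg: variety_algebra scale_free_alg "(*)"
proof unfold_locales
  fix a b c :: "('x, 'k::field) free_alg"
  show "associator (*) a b c + associator (*) a c b = 0"
    unfolding associator_def
    by transfer (simp add: ideal_rel_def identity_ideal.right_alternative[unfolded associator_def])
  show "associator (*) a b c + associator (*) b a c = 0"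
    unfolding associator_def
    by transfer (simp add: ideal_rel_def identity_ideal.left_alternative[unfolded associator_def])
  show "a * b * c + c * b * a = a * c * b + c * a * b"
    by transfer (simp only: ideal_rel_def identity_ideal.third_identity)
qed (transfer, simp add: ideal_rel_refl nafree.scale_right_distrib nafree.scale_left_distrib
      nafree.mult_add_left nafree.mult_add_right nafree.mult_scale_left nafree.mult_scale_right)+


subsection \<open>Universal property\<close>

definition algebra_hom ::
  "('k \<Rightarrow> 'a::ab_group_add \<Rightarrow> 'a) \<Rightarrow> ('a \<Rightarrow> 'a \<Rightarrow> 'a) \<Rightarrow>
   ('k \<Rightarrow> 'b::ab_group_add \<Rightarrow> 'b) \<Rightarrow> ('b \<Rightarrow> 'b \<Rightarrow> 'b) \<Rightarrow> ('a \<Rightarrow> 'b) \<Rightarrow> bool" where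
  "algebra_hom scale mult scale' mult' h \<longleftrightarrow>
    (\<forall>a b. h (a + b) = h a + h b) \<and> (\<forall>r a. h (scale r a) = scale' r (h a)) \<and>
    (\<forall>a b. h (mult a b) = mult' (h a) (h b))"

primrec eval_magma :: "('a \<Rightarrow> 'a \<Rightarrow> 'a) \<Rightarrow> ('x \<Rightarrow> 'a) \<Rightarrow> 'x magma \<Rightarrow> 'a" where
  "eval_magma mult f (Var x) = f x"
| "eval_magma mult f (App s t) = mult (eval_magma mult f s) (eval_magma mult f t)"

definition eval_nafree :: "('k::field \<Rightarrow> 'a::ab_group_add \<Rightarrow> 'a) \<Rightarrow> ('a \<Rightarrow> 'a \<Rightarrow> 'a) \<Rightarrow>
    ('x \<Rightarrow> 'a) \<Rightarrow> ('x, 'k) nafree \<Rightarrow> 'a" where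
  "eval_nafree scale mult f p =
    (\<Sum>s\<in>Poly_Mapping.keys p. scale (Poly_Mapping.lookup p s) (eval_magma mult f s))"

context nonassoc_algebra
begin

abbreviation "ev \<equiv> eval_nafree scale mult"

lemma mult_zero: "mult 0 a = 0" "mult a 0 = 0"
  using mult_add_left[of 0 0 a] mult_add_right[of a 0 0] by auto

lemma mult_sum_left: "mult (sum g A) b = (\<Sum>i\<in>A. mult (g i) b)"
  by (induction A rule: infinite_finite_induct) (auto simp: mult_zero mult_add_left)

lemma mult_sum_right: "mult b (sum g A) = (\<Sum>i\<in>A. mult b (g i))"
  by (induction A rule: infinite_finite_induct) (auto simp: mult_zero mult_add_right)

lemma eval_nafree_superset:
  assumes "finite A" "Poly_Mapping.keys p \<subseteq> A"
  shows "ev f p = (\<Sum>s\<in>A. scale (Poly_Mapping.lookup p s) (eval_magma mult f s))"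
  unfolding eval_nafree_def
  by (rule sum.mono_neutral_left) (use assms in \<open>auto simp: in_keys_iff\<close>)

lemma eval_nafree_add: "ev f (p + q) = ev f p + ev f q"
proof -
  let ?A = "Poly_Mapping.keys p \<union> Poly_Mapping.keys q"
  have "finite ?A" "Poly_Mapping.keys (p + q) \<subseteq> ?A"
    by (auto dest: keys_add[THEN subsetD])
  then show ?thesis
    by (simp add: eval_nafree_superset[of ?A] lookup_add scale_left_distrib sum.distrib)
qed

lemma eval_nafree_scale: "ev f (nafree_scale r p) = scale r (ev f p)"
proof -
  have "Poly_Mapping.keys (nafree_scale r p) \<subseteq> Poly_Mapping.keys p"
    by (auto simp: in_keys_iff)
  then show ?thesis
    by (simp add: eval_nafree_superset[of "Poly_Mapping.keys p"] scale_sum_right)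
qed

lemma eval_nafree_single: "ev f (Poly_Mapping.single s r) = scale r (eval_magma mult f s)"
  by (simp add: eval_nafree_def)

lemma eval_nafree_sum: "ev f (sum g A) = (\<Sum>i\<in>A. ev f (g i))"
  by (induction A rule: infinite_finite_induct) (auto simp: eval_nafree_add eval_nafree_def[of _ _ _ 0])

lemma eval_nafree_mult: "ev f (nafree_mult p q) = mult (ev f p) (ev f q)"
proof -
  have "ev f (nafree_mult p q) =
      (\<Sum>s\<in>Poly_Mapping.keys p. \<Sum>t\<in>Poly_Mapping.keys q.
        scale (Poly_Mapping.lookup p s * Poly_Mapping.lookup q t)
          (mult (eval_magma mult f s) (eval_magma mult f t)))"
    by (simp add: nafree_mult_def eval_nafree_sum eval_nafree_single)
  also have "\<dots> = mult (ev f p) (ev f q)"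
    unfolding eval_nafree_def mult_sum_left
    by (simp add: mult_sum_right mult_scale_left mult_scale_right scale_sum_right
        mult.commute)
  finally show ?thesis .
qed

lemma eval_nafree_diff: "ev f (p - q) = ev f p - ev f q"
  using eval_nafree_add[of f "p - q" q] by simp

lemma nafree_expand:
  "(p :: ('x, 'k) nafree) = (\<Sum>s\<in>Poly_Mapping.keys p.
      nafree_scale (Poly_Mapping.lookup p s) (Poly_Mapping.single s 1))"
proof (rule poly_mapping_eqI)
  fix t
  have "(\<Sum>s\<in>Poly_Mapping.keys p. Poly_Mapping.lookup p s * (1 when s = t))
      = (\<Sum>s\<in>Poly_Mapping.keys p. if s = t then Poly_Mapping.lookup p t else 0)"
    by (intro sum.cong) (auto simp: when_def)
  then show "Poly_Mapping.lookup p t = Poly_Mapping.lookup (\<Sum>s\<in>Poly_Mapping.keys p.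
      nafree_scale (Poly_Mapping.lookup p s) (Poly_Mapping.single s 1)) t"
    by (simp add: lookup_sum lookup_single in_keys_iff)
qed

end

lemma (in variety_algebra) eval_nafree_identity_ideal:
  "p \<in> identity_ideal \<Longrightarrow> ev f p = 0"
proof (induction rule: identity_ideal.induct)
  case (third_identity a b c)
  then show ?case
    using variety_algebra.third_identity[OF variety_algebra_axioms, of "ev f a" "ev f b" "ev f c"]
    by (simp add: eval_nafree_add eval_nafree_diff eval_nafree_mult)
qed (simp_all add: eval_nafree_add eval_nafree_diff eval_nafree_mult eval_nafree_scale mult_zero
  associator_def right_alternative[unfolded associator_def]
  left_alternative[unfolded associator_def] eval_nafree_def[of _ _ _ 0])

theorem (in variety_algebra) free_alg_universal:
  fixes f :: "'x \<Rightarrow> 'a"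
  shows "\<exists>!h. algebra_hom scale_free_alg (*) scale mult h \<and> (\<forall>x. h (gen x) = f x)"
proof (rule ex_ex1I)
  define h where "h = (\<lambda>a :: ('x, 'k) free_alg. ev f (rep_free_alg a))"
  have h_abs: "h (abs_free_alg p) = ev f p" for p
  proof -
    have "ideal_rel (rep_free_alg (abs_free_alg p)) p"
      by (rule Quotient_rep_abs[OF Quotient_free_alg]) (rule ideal_rel_refl)
    then show ?thesis
      using eval_nafree_identity_ideal[of "rep_free_alg (abs_free_alg p) - p" f]
      by (simp add: ideal_rel_def h_def eval_nafree_diff)
  qed
  have "h (a + b) = h a + h b" "h (scale_free_alg r a) = scale r (h a)"
    "h (a * b) = mult (h a) (h b)" for a b r
    by (induction a rule: free_alg.abs_induct, induction b rule: free_alg.abs_induct,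
      simp add: plus_free_alg.abs_eq scale_free_alg.abs_eq times_free_alg.abs_eq h_abs
        eval_nafree_add eval_nafree_scale eval_nafree_mult)+
  moreover have "h (gen x) = f x" for x
    by (simp add: gen_def h_abs eval_nafree_single)
  ultimately show "\<exists>h. algebra_hom scale_free_alg (*) scale mult h \<and> (\<forall>x. h (gen x) = f x)"
    unfolding algebra_hom_def by blast
next
  fix h h' :: "('x, 'k) free_alg \<Rightarrow> 'a"
  have unique: "g (abs_free_alg p) = ev f p"
    if g: "algebra_hom scale_free_alg (*) scale mult g" "\<forall>x. g (gen x) = f x" for g p
  proof -
    let ?g = "\<lambda>p. g (abs_free_alg p)"
    have add: "?g (p + q) = ?g p + ?g q" for p q
      using g by (simp add: algebra_hom_def flip: plus_free_alg.abs_eq)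
    have sc: "?g (nafree_scale r p) = scale r (?g p)" for r p
      using g by (simp add: algebra_hom_def flip: scale_free_alg.abs_eq)
    have mon: "?g (Poly_Mapping.single s 1) = eval_magma mult f s" for s
    proof (induction s)
      case (Var x)
      then show ?case using g by (simp add: gen_def)
    next
      case (App s t)
      have "Poly_Mapping.single (App s t) (1 :: 'k) =
          nafree_mult (Poly_Mapping.single s 1) (Poly_Mapping.single t 1)"
        by (simp add: nafree_mult_def)
      with App g show ?case by (simp add: algebra_hom_def flip: times_free_alg.abs_eq)
    qed
    have z: "?g 0 = 0" using add[of 0 0] by simp
    have "?g (sum u A) = (\<Sum>i\<in>A. ?g (u i))" for u and A :: "'x magma set"
      by (induction A rule: infinite_finite_induct) (auto simp: z add)
    then have "?g p = (\<Sum>s\<in>Poly_Mapping.keys p. scale (Poly_Mapping.lookup p s) (eval_magma mult f s))"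
      using arg_cong[OF nafree_expand[of p], of ?g] by (simp add: sc mon)
    then show ?thesis by (simp add: eval_nafree_def)
  qed
  assume "algebra_hom scale_free_alg (*) scale mult h \<and> (\<forall>x. h (gen x) = f x)"
    and "algebra_hom scale_free_alg (*) scale mult h' \<and> (\<forall>x. h' (gen x) = f x)"
  then have "h (abs_free_alg p) = h' (abs_free_alg p)" for p
    using unique by metis
  then have "h a = h' a" for a
    by (induction a rule: free_alg.abs_induct) simp
  then show "h = h'" by (rule ext)
qed


section \<open>The sets of the basis\<close>

text \<open>The generators \<open>x\<^sub>1, x\<^sub>2, \<dots>\<close> are \<open>gen 0, gen 1, \<dots>\<close>.\<close>

definition basis1 :: "(nat, 'k::field) free_alg set" where
  "basis1 = {gen i | i. True}"

definition basis2 :: "(nat, 'k::field) free_alg set" where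
  "basis2 = {gen i * gen r | i r. True}"

definition basis3 :: "(nat, 'k::field) free_alg set" where
  "basis3 = \<Union> {{(gen i * gen j) * gen k, (gen i * gen k) * gen j, (gen j * gen i) * gen k, (gen k * gen i) * gen j,
      gen k * (gen i * gen j), (gen j * gen i) * gen i, (gen i * gen i) * gen j, (gen i * gen i) * gen i}
    | i j k. i \<le> j \<and> j \<le> k}"

definition basis4 :: "(nat, 'k::field) free_alg set" where
  "basis4 = \<Union> {{((gen i * gen j) * gen k) * gen l, ((gen i * gen j) * gen l) * gen k, ((gen j * gen i) * gen k) * gen l,
      ((gen k * gen i) * gen j) * gen l, ((gen l * gen i) * gen j) * gen k, (gen k * (gen i * gen j)) * gen l,
      ((gen j * gen i) * gen i) * gen i, ((gen i * gen i) * gen i) * gen j, ((gen j * gen i) * gen i) * gen j,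
      ((gen i * gen i) * gen j) * gen j, ((gen k * gen i) * gen i) * gen j, ((gen j * gen i) * gen i) * gen k,
      ((gen i * gen i) * gen j) * gen k}
    | i j k l. i \<le> j \<and> j \<le> k \<and> k \<le> l}"

text \<open>\<open>left_normed a [b\<^sub>2, \<dots>, b\<^sub>n]\<close> is \<open>(\<dots>((a b\<^sub>2) b\<^sub>3)\<dots>) b\<^sub>n\<close>.\<close>

definition left_normed :: "'a::times \<Rightarrow> 'a list \<Rightarrow> 'a" where
  "left_normed a bs = foldl (*) a bs"

definition basis_long :: "nat \<Rightarrow> (nat, 'k::field) free_alg set" where
  "basis_long n = {left_normed (gen i) (map gen js) | i js. length js = n - 1 \<and> sorted js}"

definition basis_set :: "nat \<Rightarrow> (nat, 'k::field) free_alg set" where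
  "basis_set n =
    (if n = 1 then basis1 else if n = 2 then basis2 else if n = 3 then basis3
     else if n = 4 then basis4 else if n \<ge> 5 then basis_long n else {})"

definition is_basis :: "('k::field \<Rightarrow> 'a::ab_group_add \<Rightarrow> 'a) \<Rightarrow> 'a set \<Rightarrow> bool" where
  "is_basis scale B \<longleftrightarrow> \<not> module.dependent scale B \<and> module.span scale B = UNIV"

end

theory Submission
  imports Defs "HOL-Library.Multiset" "HOL-Library.Product_Plus" "HOL-Library.Function_Algebras"
begin

text \<open>The associator \<open>A a b c\<close> alternates by the two alternative laws, and the third identity says that
  \<open>tail_swap a b c = (ab)c - (ac)b\<close> is invariant under a cyclic shift of its arguments; as it is
  skew in \<open>b, c\<close>, it alternates too. So the variety consists of the algebras in which these two
  trilinear functions alternate. Where both vanish, the algebra is associative with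
  \<open>abc = acb\<close>; the free algebra with these laws has the left-normed monomials with sorted tails
  as its basis. Let \<open>I\<close> be the ideal of the free algebra of the variety that all values of the two
  functions generate. The theorem says how large \<open>I\<close> is: in degree three two alternating functions
  of the generators span it, in degree four again two, and from degree five on it is zero. This
  accounts for the two words \<open>(x\<^sub>ix\<^sub>k)x\<^sub>j\<close>, \<open>x\<^sub>k(x\<^sub>ix\<^sub>j)\<close> of degree three and the two words
  \<open>((x\<^sub>ix\<^sub>j)x\<^sub>l)x\<^sub>k\<close>, \<open>(x\<^sub>k(x\<^sub>ix\<^sub>j))x\<^sub>l\<close> of degree four that are not left-normed with sorted tail, and
  also for why they are new only if the indices are distinct.

  In degree four everything follows from \<open>b A(a,b,c) = 0 = A(a,b,c) b\<close> (\<open>com_A_self\<close>,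
  \<open>mult_A_self\<close>), which needs division by two and by three. It makes \<open>a A(b,c,d)\<close>,
  \<open>A(a,b,c) d\<close> and \<open>A(ab,c,d)\<close> alternate in all four arguments, like \<open>a[b,cd]\<close>, and two
  linear relations (\<open>prod_com_eq\<close>, \<open>triple_prod_assoc\<close>) express all of them by the first two.
  In degree five, a function of this kind with a product among its arguments is skew in so many
  ways that it vanishes: for \<open>A((ab)c,d,e)\<close> the symmetries alone say that it equals its own
  negative (\<open>prod_assoc_product\<close>), and for \<open>A(ab,c,d)e\<close> two computations of \<open>(aA(b,c,d))e\<close>
  give four times and minus three times it, so that it is zero after division by seven
  (\<open>prod_assoc_mult_zero\<close>).

  Spanning is then a normal form computation: in degree at least five every monomial equals the
  left-normed one with the same sequence of leaves, and its tail may be permuted; in lower degree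
  the corrections lie in the span of the values just described (\<open>eval_in_subspace\<close>).

  For independence two algebras of the variety suffice. In pairs \<open>(u, p)\<close> of commutative
  polynomials with product \<open>(u, p)(v, q) = (uq, pq)\<close> a left-normed monomial is determined by its
  head and the multiset of its tail. The other one, \<open>alt_alg\<close>, is the Grassmann envelope of a
  superalgebra with one odd generator; it detects the alternating functions. The functionals
  obtained from the two algebras form a triangular system on the proposed basis.\<close>

section \<open>Associators and commutators in degree three\<close>

locale variety_algebra_char_0 = variety_algebra scale mult
  for scale :: "'k::field_char_0 \<Rightarrow> 'a::ab_group_add \<Rightarrow> 'a"
  and mult :: "'a \<Rightarrow> 'a \<Rightarrow> 'a" (infixl "\<cdot>" 70)
begin

lemma mult_minus_left: "- a \<cdot> b = - (a \<cdot> b)"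
  using mult_add_left[of "- a" a b] by (simp add: mult_zero eq_neg_iff_add_eq_0)

lemma mult_minus_right: "a \<cdot> - b = - (a \<cdot> b)"
  using mult_add_right[of a "- b" b] by (simp add: mult_zero eq_neg_iff_add_eq_0)

lemma mult_diff_left: "(a - b) \<cdot> c = a \<cdot> c - b \<cdot> c"
  using mult_add_left[of "a - b" b c] by (simp add: algebra_simps)

lemma mult_diff_right: "a \<cdot> (b - c) = a \<cdot> b - a \<cdot> c"
  using mult_add_right[of a "b - c" c] by (simp add: algebra_simps)

lemmas mult_simps = mult_add_left mult_add_right mult_minus_left mult_minus_right
  mult_diff_left mult_diff_right mult_zero

text \<open>The divisions by two, three and seven in the derivation of the identities rest on this. The
  multiple \<open>n x\<close> is an iterated sum because the relations come as repeated sums, without scalars.\<close>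

lemma torsion_free:
  fixes x :: 'a
  assumes "n > 0" and "((+) x ^^ n) 0 = 0"
  shows "x = 0"
proof -
  have "((+) x ^^ n) 0 = scale (of_nat n) x"
    by (induction n) (simp_all add: scale_left_distrib)
  then show ?thesis
    using assms by simp
qed

lemma double_eq_0: "x + x = 0 \<Longrightarrow> x = (0 :: 'a)"
  using torsion_free[of 2 x] by (simp add: numeral_2_eq_2)

lemma triple_eq_0: "x + x + x = 0 \<Longrightarrow> x = (0 :: 'a)"
  using torsion_free[of 3 x] by (simp add: numeral_3_eq_3 add.assoc)

lemma eq_neg_self: "x = - x \<Longrightarrow> x = (0 :: 'a)"
  by (metis double_eq_0 add.left_inverse)

abbreviation A :: "'a \<Rightarrow> 'a \<Rightarrow> 'a \<Rightarrow> 'a" where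
  "A \<equiv> associator mult"

definition com :: "'a \<Rightarrow> 'a \<Rightarrow> 'a" where
  "com a b = a \<cdot> b - b \<cdot> a"

definition tail_swap :: "'a \<Rightarrow> 'a \<Rightarrow> 'a \<Rightarrow> 'a" where
  "tail_swap a b c = a \<cdot> b \<cdot> c - a \<cdot> c \<cdot> b"

definition mult_com :: "'a \<Rightarrow> 'a \<Rightarrow> 'a \<Rightarrow> 'a" where
  "mult_com a b c = a \<cdot> com b c"

lemmas A_def = associator_def[of mult]

lemma A_simps:
  "A (a + b) c d = A a c d + A b c d" "A a (b + c) d = A a b d + A a c d"
  "A a b (c + d) = A a b c + A a b d"
  "A (a - b) c d = A a c d - A b c d" "A a (b - c) d = A a b d - A a c d"
  "A a b (c - d) = A a b c - A a b d"
  by (simp_all add: A_def mult_simps algebra_simps)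

lemma A_alternating: "A b a c = - A a b c" "A a c b = - A a b c"
  using left_alternative[of b a c] right_alternative[of a c b]
  by (simp_all add: eq_neg_iff_add_eq_0)

lemma A_cyclic: "A a b c = A b c a"
  by (metis A_alternating minus_minus)

lemma A_reverse: "A c b a = - A a b c"
  by (metis A_alternating minus_minus)

text \<open>The third identity rearranges to the cyclic symmetry \<open>c\<close> below; with the built-in skew-symmetry
  in the last two arguments it gives the skew-symmetry in the first two.\<close>

lemma tail_swap_alternating: "tail_swap b a c = - tail_swap a b c" "tail_swap a c b = - tail_swap a b c"
proof -
  have c: "tail_swap a b c = tail_swap c a b" for a b c
    using third_identity[of a b c] by (simp add: tail_swap_def algebra_simps)
  show s: "tail_swap a c b = - tail_swap a b c" for a b c
    by (simp add: tail_swap_def)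
  show "tail_swap b a c = - tail_swap a b c"
    by (metis c s)
qed

text \<open>Hence \<open>a[b,c]\<close> alternates as well, and it replaces \<open>tail_swap\<close> in most computations.\<close>

lemma tail_swap_eq: "tail_swap a b c = mult_com a b c + A a b c + A a b c"
  using A_alternating(2)[of a b c] by (simp add: tail_swap_def mult_com_def com_def
      A_def mult_simps algebra_simps)

lemma mult_com_alternating: "mult_com b a c = - mult_com a b c" "mult_com a c b = - mult_com a b c"
proof -
  show "mult_com b a c = - mult_com a b c"
    using tail_swap_eq[of a b c] tail_swap_eq[of b a c] A_alternating(1)[of b a c]
        tail_swap_alternating(1)[of b a c]
    by (simp add: algebra_simps)
  show "mult_com a c b = - mult_com a b c"
    by (simp add: mult_com_def com_def mult_simps)
qed

lemma mult_com_cyclic: "mult_com a b c = mult_com b c a"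
  by (metis mult_com_alternating minus_minus)

text \<open>Words of degree three with a repeated letter have few different values: left and right
  multiplication by \<open>a\<close> satisfy \<open>L\<^sup>2 = LR = RL\<close>, with \<open>R\<^sup>2\<close> as the only exception.\<close>

lemma self_products: "a \<cdot> (a \<cdot> b) = a \<cdot> a \<cdot> b" "a \<cdot> (b \<cdot> a) = a \<cdot> a \<cdot> b" "a \<cdot> b \<cdot> a = a \<cdot> a \<cdot> b"
  "b \<cdot> (a \<cdot> a) = b \<cdot> a \<cdot> a"
proof -
  have "A a a b = 0" and "tail_swap a a b = 0"
    by (rule eq_neg_self, rule A_alternating(1) tail_swap_alternating(1))+
  moreover from this have "A a b a = 0" "A b a a = 0"
    using A_cyclic[of a a b] A_cyclic[of b a a] by simp_all
  ultimately show "a \<cdot> (a \<cdot> b) = a \<cdot> a \<cdot> b" "a \<cdot> (b \<cdot> a) = a \<cdot> a \<cdot> b" "a \<cdot> b \<cdot> a = a \<cdot> a \<cdot> b"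
    "b \<cdot> (a \<cdot> a) = b \<cdot> a \<cdot> a"
    by (auto simp: A_def tail_swap_def)
qed

lemma A_self: "A a a b = 0" "A a b a = 0" "A b a a = 0"
  by (simp_all add: A_def self_products)

text \<open>The linearization of \<open>[a, ab] = 0\<close>.\<close>

lemma com_mult_alternating: "com b (a \<cdot> c) = - com a (b \<cdot> c)"
proof -
  have "com b (a \<cdot> c) + com a (b \<cdot> c) = tail_swap a b c + tail_swap b a c - (A a b c + A b a c)"
    by (simp add: com_def tail_swap_def A_def algebra_simps)
  then show ?thesis
    using A_alternating(1)[of b a c] tail_swap_alternating(1)[of b a c]
        by (simp add: eq_neg_iff_add_eq_0)
qed

text \<open>The Teichmueller identity, valid in every nonassociative algebra.\<close>

lemma teichmueller:
  "A (a \<cdot> b) c d - A a (b \<cdot> c) d + A a b (c \<cdot> d) = a \<cdot> A b c d + A a b c \<cdot> d"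
  by (simp add: A_def mult_simps)

text \<open>These laws hold in every alternative algebra; they are linear combinations of instances of the
  Teichmueller identity with a repeated letter.\<close>

lemma A_mult_self:
  shows "A x (y \<cdot> x) z = x \<cdot> A x y z" and "A x (x \<cdot> y) z = A x y z \<cdot> x"
    and "A (x \<cdot> x) y z = x \<cdot> A x y z + A x y z \<cdot> x"
proof -
  have i: "A (x \<cdot> x) y z = A x (x \<cdot> y) z + x \<cdot> A x y z" for y z
    using teichmueller[of x x y z] by (simp add: A_self mult_simps algebra_simps)
  have ii: "A (x \<cdot> x) y z = A x (y \<cdot> x) z + A x y z \<cdot> x"
    using teichmueller[of z y x x] A_reverse[of z y "x \<cdot> x"] A_reverse[of z "y \<cdot> x" x]
      A_reverse[of z y x]
    by (simp add: A_self mult_simps algebra_simps)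
  have anti: "A x (x \<cdot> z) y = - A x (x \<cdot> y) z"
  proof -
    have "A x (x \<cdot> z) y + A x (x \<cdot> y) z
        = (A (x \<cdot> x) z y + A (x \<cdot> x) y z) - x \<cdot> (A x z y + A x y z)"
      using i[of y z] i[of z y] by (simp add: mult_simps)
    also have "\<dots> = 0"
      by (simp add: A_alternating(2)[of _ z y] mult_simps)
    finally show ?thesis
      by (simp add: eq_neg_iff_add_eq_0)
  qed
  have "A (x \<cdot> y) x z - A x (y \<cdot> x) z + A x y (x \<cdot> z) = x \<cdot> A y x z"
    using teichmueller[of x y x z] by (simp add: A_self mult_simps)
  moreover have "A (x \<cdot> y) x z = - A x (x \<cdot> y) z" "A x y (x \<cdot> z) = A x (x \<cdot> y) z"
    "A y x z = - A x y z"
    using A_alternating(1)[of "x \<cdot> y" x z] A_alternating(2)[of x y "x \<cdot> z"]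
        A_alternating(1)[of y x z] anti by simp_all
  ultimately show m2: "A x (y \<cdot> x) z = x \<cdot> A x y z"
    by (simp add: mult_simps)
  with i[of y z] ii show "A x (x \<cdot> y) z = A x y z \<cdot> x"
    "A (x \<cdot> x) y z = x \<cdot> A x y z + A x y z \<cdot> x"
    by (simp_all add: algebra_simps)
qed

text \<open>By the cyclic symmetry of \<open>a[b,c]\<close>, these are also the products \<open>(cd)[a,b]\<close>. They
  alternate in \<open>a, b, c\<close> by the symmetries of degree three; that \<open>d\<close> takes part in the alternation
  is the hard point.\<close>

definition prod_com :: "'a \<Rightarrow> 'a \<Rightarrow> 'a \<Rightarrow> 'a \<Rightarrow> 'a" where
  "prod_com a b c d = a \<cdot> com b (c \<cdot> d)"

lemma prod_com_mult_com: "prod_com a b c d = mult_com a b (c \<cdot> d)" "c \<cdot> d \<cdot> com a b = prod_com a b c d"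
proof -
  show "prod_com a b c d = mult_com a b (c \<cdot> d)"
    by (simp add: mult_com_def prod_com_def)
  also have "\<dots> = mult_com (c \<cdot> d) a b"
    by (simp only: mult_com_cyclic[of "c \<cdot> d" a b])
  finally show "c \<cdot> d \<cdot> com a b = prod_com a b c d"
    by (simp add: mult_com_def)
qed

lemma prod_com_swap12: "prod_com b a c d = - prod_com a b c d"
  by (simp add: prod_com_mult_com(1) mult_com_alternating(1)[of b a])

lemma prod_com_swap23: "prod_com a c b d = - prod_com a b c d"
  by (simp add: prod_com_def com_mult_alternating[of c b] mult_minus_right)

text \<open>The element \<open>(a[b,c])c\<close> can be evaluated in two ways. Cyclic symmetry turns it into
  \<open>(c[a,b])c = c\<^sup>2[a,b] = a[b,c\<^sup>2]\<close>, and \<open>[b,c\<^sup>2] = [b,c]c\<close>. So \<open>a, [b,c], c\<close> associate, which by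
  \<open>A_mult_self\<close> says that \<open>c\<close> commutes with the associator.\<close>

lemma com_A_self: "c \<cdot> A a b c = A a b c \<cdot> c"
proof -
  let ?z = "com b c"
  have z: "?z \<cdot> c = com b (c \<cdot> c)"
    by (simp add: com_def mult_simps self_products(4) self_products(3)[of c b])
  have "a \<cdot> ?z = c \<cdot> com a b"
    using mult_com_cyclic[of c a b] by (simp add: mult_com_def)
  then have "a \<cdot> ?z \<cdot> c = c \<cdot> c \<cdot> com a b"
    by (simp add: self_products)
  also have "\<dots> = a \<cdot> (?z \<cdot> c)"
    by (simp only: prod_com_mult_com(2) z) (simp add: prod_com_def)
  finally have "A a ?z c = 0"
    by (simp add: A_def)
  then have "A a (b \<cdot> c) c = A a (c \<cdot> b) c"
    by (simp add: com_def A_simps)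
  then have "A c (b \<cdot> c) a = A c (c \<cdot> b) a"
    by (metis A_cyclic A_alternating(1))
  then have "c \<cdot> A c b a = A c b a \<cdot> c"
    by (simp add: A_mult_self)
  moreover have "A c b a = - A a b c"
    by (metis A_cyclic A_alternating(1))
  ultimately show ?thesis
    by (simp add: mult_simps)
qed

text \<open>Compute \<open>tail_swap (ab) c b\<close> by the right Moufang identity \<open>((ab)c)b = a(b\<^sup>2c)\<close> and compare it with
  its expression by \<open>(ab)[c,b]\<close> and an associator; the associators cancel because \<open>b\<close> commutes
  with them.\<close>

lemma prod_com_repeat: "prod_com c b a b = 0"
proof -
  have A: "A (a \<cdot> b) c b = - (b \<cdot> A a b c)"
    using A_mult_self(1)[of b a c] A_cyclic[of "a \<cdot> b" c b] A_cyclic[of b "a \<cdot> b" c]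
      A_alternating(1)[of b a c] by (simp add: mult_simps)
  have "A a b (c \<cdot> b) = b \<cdot> A a b c"
    using A_mult_self(1)[of b c a] A_cyclic[of a b c] A_cyclic[of a b "c \<cdot> b"] by simp
  with A have "a \<cdot> b \<cdot> c \<cdot> b = a \<cdot> (b \<cdot> b \<cdot> c)"
    by (simp add: A_def self_products algebra_simps)
  then have "tail_swap (a \<cdot> b) c b = - A a (b \<cdot> b) c"
    by (simp add: tail_swap_def A_def self_products)
  also have "\<dots> = - (b \<cdot> A a b c + b \<cdot> A a b c)"
    using A_mult_self(3)[of b a c] A_alternating(1)[of "b \<cdot> b" a c]
        A_alternating(1)[of b a c] com_A_self[of b c a]
      A_cyclic[of a b c] A_cyclic[of b c a]
    by (simp add: mult_simps)
  finally have "mult_com (a \<cdot> b) c b = 0"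
    using tail_swap_eq[of "a \<cdot> b" c b] A by (simp add: algebra_simps)
  then show ?thesis
    by (simp add: mult_com_def prod_com_mult_com(2))
qed

text \<open>The same comparison for \<open>tail_swap (ba) c b\<close>, where the term \<open>(ba)[c,b]\<close> is already known to be
  zero. Now the associators add up to three times the claim.\<close>

lemma mult_A_self: "b \<cdot> A a b c = 0"
proof -
  have eq: "A a b c \<cdot> b = b \<cdot> A a b c" and A1: "A b a c = - A a b c"
    using com_A_self[of b c a] A_cyclic[of a b c] A_cyclic[of b c a] A_alternating(1)[of b a c]
        by simp_all
  have "mult_com (b \<cdot> a) c b = 0"
    using eq_neg_self[OF prod_com_swap23[of c b b a]] by (simp add: mult_com_def prod_com_mult_com(2))
  then have "tail_swap (b \<cdot> a) c b = A (b \<cdot> a) c b + A (b \<cdot> a) c b"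
    by (simp add: tail_swap_eq)
  also have "A (b \<cdot> a) c b = - (b \<cdot> A a b c)"
    using A_mult_self(2)[of b a c] A_cyclic[of "b \<cdot> a" c b] A_cyclic[of b "b \<cdot> a" c] A1 eq
    by (simp add: mult_simps)
  finally have "tail_swap (b \<cdot> a) c b = - (b \<cdot> A a b c) - b \<cdot> A a b c"
    by simp
  moreover have "b \<cdot> a \<cdot> c \<cdot> b = b \<cdot> b \<cdot> (a \<cdot> c) - b \<cdot> A a b c"
  proof -
    have "b \<cdot> a \<cdot> c \<cdot> b = (b \<cdot> (a \<cdot> c)) \<cdot> b + A b a c \<cdot> b"
      by (simp add: A_def mult_simps)
    then show ?thesis
      by (simp add: self_products A1 mult_simps eq)
  qed
  moreover have "b \<cdot> a \<cdot> b \<cdot> c = b \<cdot> b \<cdot> (a \<cdot> c) - b \<cdot> A a b c - b \<cdot> A a b c"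
    using A_mult_self(3)[of b a c] by (simp add: A1 mult_simps eq A_def[of
        "b \<cdot> b"] self_products(3)[of b a] algebra_simps)
  ultimately have "b \<cdot> A a b c + b \<cdot> A a b c + b \<cdot> A a b c = 0"
    by (simp add: tail_swap_def algebra_simps)
  then show ?thesis
    by (rule triple_eq_0)
qed

section \<open>Degree four: all values alternate\<close>

definition alt4 :: "('a \<Rightarrow> 'a \<Rightarrow> 'a \<Rightarrow> 'a \<Rightarrow> 'a) \<Rightarrow> bool" where
  "alt4 f \<longleftrightarrow> (\<forall>a b c d. f b a c d = - f a b c d \<and> f a c b d = - f a b c d \<and> f a b d c = - f a b c d)"

lemma alt4D:
  assumes "alt4 f"
  shows "f b a c d = - f a b c d" "f a c b d = - f a b c d" "f a b d c = - f a b c d"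
  using assms unfolding alt4_def by blast+

lemma alt4_even:
  assumes "alt4 f"
  shows "f b c a d = f a b c d" "f a c d b = f a b c d" "f c d a b = f a b c d"
    "f b c d a = - f a b c d"
proof -
  note s = alt4D[OF assms]
  show 1: "f b c a d = f a b c d" for a b c d
    by (simp only: s(2)[of b c a d] s(1)[of b a c d] minus_minus)
  show 2: "f a c d b = f a b c d" for a b c d
    by (simp only: s(3)[of a c d b] s(2)[of a c b d] minus_minus)
  show 3: "f b c d a = - f a b c d" for a b c d
    by (simp only: s(3)[of b c d a] 1[of b c a d])
  show "f c d a b = f a b c d"
    by (simp only: 3[of c d a b] 3[of b c d a] minus_minus)
qed

text \<open>These three functions, rather than their values at generators, are studied because the arguments
  become products in degree five.\<close>

definition left_assoc where "left_assoc a b c d = a \<cdot> A b c d"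
definition right_assoc where "right_assoc a b c d = A a b c \<cdot> d"
definition prod_assoc where "prod_assoc a b c d = A (a \<cdot> b) c d"

lemma skew_from_zero:
  fixes f :: "'a \<Rightarrow> 'a \<Rightarrow> 'a"
  assumes "\<And>x. f x x = 0" and "\<And>x y z. f (x + y) z = f x z + f y z"
    and "\<And>x y z. f x (y + z) = f x y + f x z"
  shows "f y x = - f x y"
proof -
  have "f x y + f y x = 0"
    using assms(1)[of x] assms(1)[of y] assms(1)[of "x + y"]
    unfolding assms(2,3) by (simp add: add.commute)
  then show ?thesis
    by (simp add: add_eq_0_iff)
qed

lemma alt4_prod_com: "alt4 prod_com"
  unfolding alt4_def
proof (intro allI conjI)
  fix a b c d
  have "prod_com a b d d = 0" for a b d
    using prod_com_repeat[of a d b] prod_com_swap23[of a b d d] by simp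
  then show "prod_com a b d c = - prod_com a b c d"
    by (rule skew_from_zero[of "\<lambda>c d. prod_com a b c d"]) (simp_all add: prod_com_def com_def mult_simps
        algebra_simps)
qed (fact prod_com_swap12 prod_com_swap23)+

lemma alt4_left_assoc: "alt4 left_assoc"
  unfolding alt4_def
proof (intro allI conjI)
  fix a b c d
  have "left_assoc a a c d = 0" for a c d
    using mult_A_self[of a c d] A_alternating(1)[of c a d] by (simp add: left_assoc_def mult_simps)
  then show "left_assoc b a c d = - left_assoc a b c d"
    by (rule skew_from_zero[of "\<lambda>a b. left_assoc a b c d"]) (simp_all add: left_assoc_def
        A_simps mult_simps algebra_simps)
  show "left_assoc a c b d = - left_assoc a b c d" "left_assoc a b d c = - left_assoc a b c d"
    by (simp_all add: left_assoc_def mult_simps A_alternating(1)[of c b] A_alternating(2)[of _ d c])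
qed

lemma alt4_right_assoc: "alt4 right_assoc"
  unfolding alt4_def
proof (intro allI conjI)
  fix a b c d
  have "right_assoc a b c c = 0" for a b c
    using mult_A_self[of c a b] com_A_self[of c a b] A_alternating(2)[of a b c]
    by (simp add: right_assoc_def mult_simps)
  then show "right_assoc a b d c = - right_assoc a b c d"
    by (rule skew_from_zero[of "\<lambda>c d. right_assoc a b c d"]) (simp_all add: right_assoc_def
        A_simps mult_simps algebra_simps)
  show "right_assoc b a c d = - right_assoc a b c d" "right_assoc a c b d = - right_assoc a b c d"
    by (simp_all add: right_assoc_def mult_simps A_alternating(1)[of b a] A_alternating(2)[of _ c b])
qed

lemma alt4_prod_assoc: "alt4 prod_assoc"
  unfolding alt4_def
proof (intro allI conjI)
  fix a b c d
  have pq: "x \<cdot> A x y z = 0" "A x y z \<cdot> x = 0" for x y z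
    using mult_A_self[of x y z] A_alternating(1)[of y x z] com_A_self[of x y z] A_cyclic[of x y z]
    by (simp_all add: mult_simps)
  have "prod_assoc x x c d = 0" for x
    by (simp add: prod_assoc_def A_mult_self(3) pq)
  then show "prod_assoc b a c d = - prod_assoc a b c d"
    by (rule skew_from_zero[of "\<lambda>a b. prod_assoc a b c d"]) (simp_all add: prod_assoc_def
        A_simps mult_simps algebra_simps)
  have "prod_assoc a x x d = 0" for x
    using A_mult_self(1)[of x a d] pq A_alternating(1)[of "a \<cdot> x" x d] by (simp add: prod_assoc_def)
  then show "prod_assoc a c b d = - prod_assoc a b c d"
    by (rule skew_from_zero[of "\<lambda>b c. prod_assoc a b c d"]) (simp_all add: prod_assoc_def
        A_simps mult_simps algebra_simps)
  show "prod_assoc a b d c = - prod_assoc a b c d"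
    by (simp add: prod_assoc_def A_alternating(2)[of _ d c])
qed

text \<open>Both sides alternate, so it suffices to compare their sums over the cyclic shifts of \<open>b, c, d\<close>:
  there the terms \<open>a(b(cd)) - a((cd)b)\<close> regroup into associators.\<close>

lemma prod_com_eq: "prod_com a b c d = - left_assoc a b c d"
proof -
  have "(prod_com a b c d + left_assoc a b c d) + (prod_com a c d b + left_assoc a c d b) +
      (prod_com a d b c + left_assoc a d b c) = 0"
    by (simp add: prod_com_def left_assoc_def com_def A_def mult_simps algebra_simps)
  then have "(prod_com a b c d + left_assoc a b c d) + (prod_com a b c d + left_assoc a b c d) +
      (prod_com a b c d + left_assoc a b c d) = 0"
    by (simp add: alt4_even(2)[OF alt4_prod_com, of a d b c] alt4_even(2)[OF alt4_prod_com, of a c d b]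
       alt4_even(2)[OF alt4_left_assoc, of a d b c] alt4_even(2)[OF alt4_left_assoc, of a c d b])
  then show ?thesis
    by (metis triple_eq_0 eq_neg_iff_add_eq_0)
qed

text \<open>The Teichmueller identity once the three associators on its left are recognized as equal up
  to sign.\<close>

lemma triple_prod_assoc: "prod_assoc a b c d + prod_assoc a b c d + prod_assoc a b c d
    = left_assoc a b c d + right_assoc a b c d"
proof -
  have "A a (b \<cdot> c) d = - prod_assoc b c a d"
    unfolding prod_assoc_def by (rule A_alternating(1))
  moreover have "A a b (c \<cdot> d) = prod_assoc c d a b"
    unfolding prod_assoc_def by (simp only: A_cyclic[of "c \<cdot> d" a b])
  ultimately have "A a (b \<cdot> c) d = - prod_assoc a b c d" "A a b (c \<cdot> d) = prod_assoc a b c d"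
    by (simp_all only: alt4_even(1)[OF alt4_prod_assoc, of b c a d] alt4_even(3)[OF alt4_prod_assoc,
        of c d a b])
  then show ?thesis
    using teichmueller[of a b c d] by (simp add: prod_assoc_def left_assoc_def right_assoc_def)
qed

section \<open>Degree five: all values vanish\<close>

lemmas prod_assoc_swap = alt4D[OF alt4_prod_assoc] and prod_assoc_even = alt4_even[OF alt4_prod_assoc]
lemmas left_assoc_even = alt4_even[OF alt4_left_assoc] and right_assoc_even
    = alt4_even[OF alt4_right_assoc]

text \<open>The value \<open>X a b c d e = A((ab)c,d,e)\<close> alternates in its last three arguments. Moving pairs of
  arguments through \<open>A(ab,cd,e)\<close> gives \<open>X c d e a b = - X a b e c d\<close>, which extends the
  alternation to all five arguments. But the permutation in this equation exchanges two pairs and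
  is even, so \<open>X\<close> equals its negative.\<close>

lemma prod_assoc_product: "prod_assoc (a \<cdot> b) c d e = 0"
proof -
  define X where "X a b c d e = prod_assoc (a \<cdot> b) c d e" for a b c d e
  have s34: "X a b d c e = - X a b c d e" and s45: "X a b c e d = - X a b c d e" for a b c d e
    unfolding X_def by (rule prod_assoc_swap)+
  \<comment> \<open>The middle value is \<open>A (ab) (cd) e\<close>, in which the two products may be exchanged.\<close>
  have star: "X c d e a b = - X a b e c d" for a b c d e
  proof -
    have "X c d e a b = A (a \<cdot> b) (c \<cdot> d) e"
      unfolding X_def prod_assoc_even(3)[of "c \<cdot> d" e a b] by (simp only: prod_assoc_def)
    also have "\<dots> = - prod_assoc c d (a \<cdot> b) e"
      by (simp only: A_alternating(1)[of "a \<cdot> b" "c \<cdot> d"] prod_assoc_def)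
    also have "prod_assoc c d (a \<cdot> b) e = X a b e c d"
      unfolding X_def by (rule prod_assoc_even(3))
    finally show ?thesis .
  qed
  have s13: "X e d c a b = - X c d e a b" for a b c d e
    by (simp only: star[of c d e a b] s34[of a b e c d] star[of a b c e d] minus_minus)
  have rot: "X a b d e c = X a b c d e" for a b c d e
    by (simp only: s45[of a b d e c] s34[of a b d c e] minus_minus)
  have cyc: "X e c d a b = X c d e a b" for a b c d e
    by (simp only: star[of c d e a b] rot[of a b e c d] star[of a b d e c] minus_minus)
  have s14: "X a b e c d = - X c b e a d" for a b c d e
    by (simp only: s34[of a b e c d] s13[of a b c e d] s34[of c b a e d] minus_minus)
  \<comment> \<open>The double transposition that exchanges \<open>a\<close> with \<open>c\<close> and \<open>b\<close> with \<open>d\<close>.\<close>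
  have flip: "X a b e c d = X c d e a b" for a b c d e
  proof -
    have "X c b e a d = X d e c b a"
      by (simp only: cyc[of c b e a d] s45[of b e c a d] s14[of b e c d a] minus_minus)
    then show ?thesis
      by (simp only: s14[of a b e c d] s45[of d e c b a] cyc[of c d e a b] minus_minus)
  qed
  have "X c d e a b = - X c d e a b" for a b c d e
    using star[of c d e a b] by (simp only: flip[of a b e c d])
  then have "X a b c d e = 0"
    by (rule eq_neg_self)
  then show ?thesis
    by (simp only: X_def)
qed

text \<open>This function alternates in all five arguments, being both \<open>prod_assoc\<close> in its first four and
  \<open>right_assoc\<close> in \<open>ab, c, d, e\<close>. The products \<open>left_assoc a b c d \<cdot> e\<close> and \<open>right_assoc a b c d \<cdot> e\<close> turn out to be multiples of it.\<close>

definition prod_assoc_mult where "prod_assoc_mult a b c d e = A (a \<cdot> b) c d \<cdot> e"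

lemma A_degree5:
  "A (a \<cdot> b \<cdot> c) d e = 0" "A (a \<cdot> (b \<cdot> c)) d e = 0" "A (a \<cdot> b) (c \<cdot> d) e = 0"
proof -
  show 1: "A (a \<cdot> b \<cdot> c) d e = 0"
    using prod_assoc_product[of a b c d e] by (simp add: prod_assoc_def)
  show "A (a \<cdot> (b \<cdot> c)) d e = 0"
    using prod_assoc_product[of b c a d e] prod_assoc_swap(1)[of a "b \<cdot> c" d e]
        by (simp add: prod_assoc_def)
  show "A (a \<cdot> b) (c \<cdot> d) e = 0"
    using prod_assoc_product[of c d e a b] prod_assoc_even(3)[of "c \<cdot> d" e a b]
        by (simp add: prod_assoc_def)
qed

lemma A_com_degree5: "A (c \<cdot> d) (com a b) e = 0" "A (c \<cdot> d) e (com a b) = 0"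
  by (simp_all add: com_def A_simps A_degree5 A_alternating(2)[of _ e "a \<cdot> b" ] A_alternating(2)[of _ e
      "b \<cdot> a"])

lemma left_assoc_product: "left_assoc (a \<cdot> b) c d e = - prod_assoc_mult a b c d e"
  using triple_prod_assoc[of "a \<cdot> b" c d e] by (simp add: prod_assoc_product right_assoc_def
      prod_assoc_mult_def eq_neg_iff_add_eq_0)

lemma prod_assoc_mult_even: "prod_assoc_mult d e a b c = prod_assoc_mult a b c d e"
    "prod_assoc_mult a b e c d = prod_assoc_mult a b c d e" "prod_assoc_mult c d a b e
    = prod_assoc_mult a b c d e"
proof -
  show 2: "prod_assoc_mult a b e c d = prod_assoc_mult a b c d e" for a b c d e
    using right_assoc_even(2)[of "a \<cdot> b" e c d] right_assoc_even(2)[of "a \<cdot> b" d e c]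
        by (simp add: prod_assoc_mult_def right_assoc_def)
  show 3: "prod_assoc_mult c d a b e = prod_assoc_mult a b c d e" for a b c d e
    using prod_assoc_even(3)[of c d a b] by (simp add: prod_assoc_mult_def prod_assoc_def)
  show "prod_assoc_mult d e a b c = prod_assoc_mult a b c d e"
    by (simp only: 3[of d e a b c] 2[of a b d e c] 2[of a b e c d])
qed

lemma right_assoc_mult: "right_assoc a b c d \<cdot> e = - prod_assoc_mult a b c d e"
proof -
  have "A (A a b c) d e = 0"
    by (simp add: A_def[of a b c] A_simps A_degree5)
  then have "right_assoc a b c d \<cdot> e = right_assoc a b c (d \<cdot> e)"
    by (simp add: A_def[of "A a b c"] right_assoc_def)
  also have "\<dots> = - right_assoc (d \<cdot> e) a b c"
    by (rule right_assoc_even(4))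
  also have "right_assoc (d \<cdot> e) a b c = prod_assoc_mult d e a b c"
    by (simp add: right_assoc_def prod_assoc_mult_def)
  finally show ?thesis
    by (simp only: prod_assoc_mult_even(1))
qed

text \<open>Multiply \<open>triple_prod_assoc\<close> by \<open>e\<close>.\<close>

lemma left_assoc_mult: "left_assoc a b c d \<cdot> e = prod_assoc_mult a b c d e + prod_assoc_mult a b c d e
    + prod_assoc_mult a b c d e + prod_assoc_mult a b c d e"
proof -
  have "(prod_assoc a b c d + prod_assoc a b c d + prod_assoc a b c d) \<cdot> e
      = left_assoc a b c d \<cdot> e + right_assoc a b c d \<cdot> e"
    by (simp only: triple_prod_assoc mult_simps)
  then have "left_assoc a b c d \<cdot> e = (prod_assoc_mult a b c d e + prod_assoc_mult a b c d e
      + prod_assoc_mult a b c d e) - right_assoc a b c d \<cdot> e"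
    by (simp add: mult_simps prod_assoc_def prod_assoc_mult_def algebra_simps)
  then show ?thesis
    by (simp add: right_assoc_mult)
qed

text \<open>Replace \<open>aA(b,c,d)\<close> by \<open>- (cd)[a,b]\<close> and move \<open>e\<close> inside; every associator that arises has a
  product and a commutator among its arguments and vanishes.\<close>

lemma left_assoc_mult': "left_assoc a b c d \<cdot> e = - (prod_assoc_mult a b c d e
    + prod_assoc_mult a b c d e + prod_assoc_mult a b c d e)"
proof -
  have "left_assoc a b c d \<cdot> e = - (c \<cdot> d \<cdot> com a b \<cdot> e)"
    by (simp add: prod_com_mult_com(2) prod_com_eq mult_simps)
  also have "c \<cdot> d \<cdot> com a b \<cdot> e = c \<cdot> d \<cdot> (com a b \<cdot> e)"
    using A_com_degree5(1)[of c d a b e] by (simp add: A_def)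
  also have "com a b \<cdot> e = e \<cdot> com a b + com (com a b) e"
    by (simp add: com_def)
  also have "c \<cdot> d \<cdot> (e \<cdot> com a b + com (com a b) e)
      = c \<cdot> d \<cdot> e \<cdot> com a b + c \<cdot> d \<cdot> com (com a b) e"
    using A_com_degree5(2)[of c d e a b] by (simp add: A_def mult_simps)
  also have "c \<cdot> d \<cdot> e \<cdot> com a b = - left_assoc (c \<cdot> d) e a b"
    using prod_com_eq[of a b "c \<cdot> d" e] left_assoc_even(3)[of "c \<cdot> d" e a b]
        by (simp add: prod_com_mult_com(2))
  also have "\<dots> = prod_assoc_mult a b c d e"
    by (simp only: left_assoc_product minus_minus prod_assoc_mult_even(1)[of a b c d e])
  also have "c \<cdot> d \<cdot> com (com a b) e = - (left_assoc (a \<cdot> b) e c d - left_assoc (b \<cdot> a) e c d)"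
    by (simp add: prod_com_mult_com(2) prod_com_eq com_def[of a b] left_assoc_def mult_simps)
  also have "left_assoc (a \<cdot> b) e c d = - prod_assoc_mult a b c d e"
    by (simp only: left_assoc_product prod_assoc_mult_even(2))
  also have "left_assoc (b \<cdot> a) e c d = prod_assoc_mult a b c d e"
    using prod_assoc_swap(1)[of b a c d] by (simp add: left_assoc_product prod_assoc_mult_even(2)
        prod_assoc_mult_def mult_simps flip: prod_assoc_def)
  finally show ?thesis
    by (simp add: algebra_simps)
qed

lemma prod_assoc_mult_zero: "prod_assoc_mult a b c d e = 0"
proof -
  let ?Q = "prod_assoc_mult a b c d e"
  have "?Q + ?Q + ?Q + ?Q = - (?Q + ?Q + ?Q)"
    by (simp only: left_assoc_mult[symmetric] left_assoc_mult'[symmetric])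
  then have "(?Q + ?Q + ?Q) + (?Q + ?Q + ?Q + ?Q) = 0"
    by (simp only: add.right_inverse)
  then have "((+) ?Q ^^ 7) 0 = 0"
    by (simp add: numeral_eq_Suc add.assoc)
  then show ?thesis
    by (rule torsion_free[rotated]) simp
qed

lemma degree4_mult_zero: "left_assoc a b c d \<cdot> e = 0" "right_assoc a b c d \<cdot> e
    = 0" "prod_assoc a b c d \<cdot> e = 0"
  using prod_assoc_mult_zero[of a b c d e] by (simp_all add: left_assoc_mult right_assoc_mult)
      (simp add: prod_assoc_mult_def prod_assoc_def)

lemma tail_swap_product: "tail_swap (a \<cdot> b) c d = prod_assoc a b c d
    + prod_assoc a b c d - left_assoc a b c d"
proof -
  have "mult_com (a \<cdot> b) c d = - left_assoc a b c d"
    using left_assoc_even(3)[of c d a b] by (simp add: mult_com_def prod_com_mult_com(2) prod_com_eq)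
  then show ?thesis
    by (simp add: tail_swap_eq prod_assoc_def)
qed

text \<open>Both \<open>(a[b,c])d\<close> and \<open>(ad)[b,c]\<close> are compared with \<open>a(d[b,c])\<close>. With \<open>tail_swap_product\<close> this shows
  that the ideal generated by \<open>tail_swap\<close> contributes nothing to degree four beyond linear
  combinations of the values of \<open>left_assoc\<close> and \<open>right_assoc\<close>.\<close>

lemma tail_swap_mult:
  "tail_swap a b c \<cdot> d = left_assoc a b c d + right_assoc a b c d + right_assoc a b c d
    - (prod_assoc a b c d + prod_assoc a b c d + prod_assoc a b c d + prod_assoc a b c d)"
proof -
  have "A (com b c) a d = prod_assoc b c a d - prod_assoc c b a d"
    by (simp add: com_def A_simps prod_assoc_def)
  also have "\<dots> = prod_assoc a b c d + prod_assoc a b c d"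
    by (simp add: prod_assoc_swap(1)[of c b a d] prod_assoc_even(1)[of b c a d])
  finally have A: "A a (com b c) d = - (prod_assoc a b c d + prod_assoc a b c d)" "A a d (com b c)
      = prod_assoc a b c d + prod_assoc a b c d"
    by (simp_all only: A_alternating(1)[of a "com b c" d] A_cyclic[of "com b c" a d])
  have "com (com b c) d = - (com d (b \<cdot> c) - com d (c \<cdot> b))"
    by (simp add: com_def mult_simps)
  then have "a \<cdot> com (com b c) d = - (prod_com a d b c - prod_com a d c b)"
    by (simp add: prod_com_def mult_simps)
  also have "\<dots> = left_assoc a b c d + left_assoc a b c d"
    by (simp add: prod_com_eq alt4D(3)[OF alt4_left_assoc, of a d c b] left_assoc_even(2)[of a d b c]
        left_assoc_even(2)[of a c d b])
  finally have c: "a \<cdot> com (com b c) d = left_assoc a b c d + left_assoc a b c d" .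
  have "mult_com a b c \<cdot> d = a \<cdot> (com b c \<cdot> d) + A a (com b c) d"
    by (simp add: mult_com_def A_def)
  also have "com b c \<cdot> d = d \<cdot> com b c + com (com b c) d"
    by (simp add: com_def)
  also have "a \<cdot> (d \<cdot> com b c + com (com b c) d)
      = (a \<cdot> d \<cdot> com b c - A a d (com b c)) + a \<cdot> com (com b c) d"
    by (simp add: A_def mult_simps)
  also have "a \<cdot> d \<cdot> com b c = - left_assoc a b c d"
    using left_assoc_even(1)[of b c a d] by (simp add: prod_com_mult_com(2) prod_com_eq)
  finally show ?thesis
    by (simp add: tail_swap_eq mult_simps A c right_assoc_def algebra_simps)
qed

lemma tail_swap_degree5:
  "tail_swap (a \<cdot> b \<cdot> c) d e = 0" "tail_swap (a \<cdot> b) c d \<cdot> e = 0" "tail_swap a b c \<cdot> d \<cdot> e = 0"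
  by (simp_all add: tail_swap_product tail_swap_mult left_assoc_product prod_assoc_product
      prod_assoc_mult_zero mult_simps degree4_mult_zero)

end

section \<open>Monomials as left-normed words\<close>

text \<open>Adjacent transpositions generate all permutations. The function is arbitrary so that it may
  be a predicate, such as membership of a product in a subspace.\<close>

lemma swap_invariant:
  assumes "mset xs = mset ys"
    and "\<And>us b c vs. F (us @ b # c # vs) = F (us @ c # b # vs)"
  shows "F xs = F ys"
  using assms
proof (induction xs arbitrary: ys F)
  case (Cons x xs)
  then obtain us vs where ys: "ys = us @ x # vs"
    by (metis list.set_intros(1) mset_eq_setD split_list)
  have "F (us @ x # vs) = F (x # us @ vs)" for us vs
  proof (induction us arbitrary: vs rule: rev_induct)
    case (snoc u us)
    show ?case
      using Cons.prems(2)[of us u x vs] snoc[of "u # vs"] by simp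
  qed simp
  moreover have "F (x # xs) = F (x # us @ vs)"
  proof (rule Cons.IH[of _ "\<lambda>zs. F (x # zs)"])
    show "mset xs = mset (us @ vs)"
      using Cons.prems(1) by (simp add: ys)
    show "F (x # us @ b # c # vs) = F (x # us @ c # b # vs)" for us b c vs
      using Cons.prems(2)[of "x # us"] by simp
  qed
  ultimately show ?case
    by (simp add: ys)
qed simp

primrec leaves :: "'x magma \<Rightarrow> 'x list" where
  "leaves (Var x) = [x]"
| "leaves (App s t) = leaves s @ leaves t"

lemma leaves_not_Nil [simp]: "leaves m \<noteq> []"
  by (induction m) auto

lemma length_leaves_App:
  "Suc 0 < length (leaves m) \<longleftrightarrow> (\<exists>s t. m = App s t)"
proof (cases m)
  case (App s t)
  have "length (leaves s) > 0" "length (leaves t) > 0"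
    by simp_all
  then show ?thesis
    using App by (simp del: length_greater_0_conv)
qed simp

lemma length_leaves_cases:
  assumes "length (leaves m) \<le> 4"
  obtains (1) x where "m = Var x"
  | (2) x y where "m = App (Var x) (Var y)"
  | (3) x y z where "m = App (App (Var x) (Var y)) (Var z) \<or> m = App (Var x) (App (Var y) (Var z))"
  | (4) x y z w where "m = App (App (App (Var x) (Var y)) (Var z)) (Var w) \<or>
      m = App (App (Var x) (App (Var y) (Var z))) (Var w) \<or>
      m = App (App (Var x) (Var y)) (App (Var z) (Var w)) \<or>
      m = App (Var x) (App (App (Var y) (Var z)) (Var w)) \<or>
      m = App (Var x) (App (Var y) (App (Var z) (Var w)))"
proof -
  have pos: "length (leaves m) \<noteq> 0" for m :: "'a magma"
    by simp
  have l1: "\<exists>x. m = Var x" if "length (leaves m) = 1" for m :: "'a magma"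
    using that length_leaves_App[of m] by (cases m) auto
  have l2: "\<exists>x y. m = App (Var x) (Var y)" if "length (leaves m) = 2" for m :: "'a magma"
  proof (cases m)
    case (App s t)
    have "length (leaves s) + length (leaves t) = 2"
      using that App by simp
    then have "length (leaves s) = 1 \<and> length (leaves t) = 1"
      using pos[of s] pos[of t] by arith
    then show ?thesis using l1 App by blast
  qed (use that in auto)
  have l3: "\<exists>x y z. m = App (App (Var x) (Var y)) (Var z) \<or> m = App (Var x) (App (Var y) (Var z))"
    if "length (leaves m) = 3" for m :: "'a magma"
  proof (cases m)
    case (App s t)
    have "length (leaves s) + length (leaves t) = 3"
      using that App by simp
    then have "length (leaves s) = 1 \<and> length (leaves t) = 2 \<or>
        length (leaves s) = 2 \<and> length (leaves t) = 1"
      using pos[of s] pos[of t] by arith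
    then show ?thesis using l1 l2 App by blast
  qed (use that in auto)
  consider "length (leaves m) = 1" | "length (leaves m) = 2" | "length (leaves m) = 3"
      | "length (leaves m) = 4"
    using assms pos[of m] by arith
  then show ?thesis
  proof cases
    case a: 4
    show ?thesis
    proof (cases m)
      case (App s t)
      have "length (leaves s) + length (leaves t) = 4"
        using a App by simp
      then have "length (leaves s) = 1 \<and> length (leaves t) = 3 \<or> length (leaves s) = 2
          \<and> length (leaves t) = 2 \<or>
        length (leaves s) = 3 \<and> length (leaves t) = 1"
        using pos[of s] pos[of t] by arith
      then show ?thesis
        using App l1[of s] l1[of t] l2[of s] l2[of t] l3[of s] l3[of t] 4 by metis
    qed (use a in auto)
  qed (use l1 l2 l3 1 2 3 in metis)+
qed

context variety_algebra_char_0
begin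

lemma foldl_mult_diff: "foldl (\<cdot>) (u - v) ys = foldl (\<cdot>) u ys - foldl (\<cdot>) v ys"
  by (induction ys arbitrary: u v) (simp_all add: mult_diff_left)

lemma foldl_mult_0: "foldl (\<cdot>) 0 ys = 0"
  by (induction ys) (simp_all add: mult_zero)

lemma foldl_tail_swap:
  "foldl (\<cdot>) a (us @ b # c # vs) - foldl (\<cdot>) a (us @ c # b # vs)
      = foldl (\<cdot>) (tail_swap (foldl (\<cdot>) a us) b c) vs"
  by (simp add: tail_swap_def foldl_mult_diff)

text \<open>The total degree is at least five: there are the head, \<open>b\<close>, \<open>c\<close> and two more letters.\<close>

lemma foldl_tail_swap_zero:
  assumes "length us + length vs \<ge> 2"
  shows "foldl (\<cdot>) (tail_swap (foldl (\<cdot>) a us) b c) vs = 0"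
proof -
  consider d e where "vs = d # e" "us = []" "e \<noteq> []" | d vs' u where "us = [u]" "vs = d # vs'"
    | us' d e where "us = us' @ [d, e]"
    using assms
    by (cases us rule: rev_cases; cases "butlast us" rule: rev_cases; cases vs) (auto simp: Suc_le_eq)
  then show ?thesis
  proof cases
    case (1 d e)
    then show ?thesis
      by (cases e) (simp_all add: tail_swap_degree5 foldl_mult_0)
  qed (simp_all add: tail_swap_degree5 foldl_mult_0)
qed

definition lnprod :: "'a list \<Rightarrow> 'a" where
  "lnprod xs = foldl (\<cdot>) (hd xs) (tl xs)"

lemma lnprod_snoc: "xs \<noteq> [] \<Longrightarrow> lnprod (xs @ [x]) = lnprod xs \<cdot> x"
  by (simp add: lnprod_def)

abbreviation evm :: "('x \<Rightarrow> 'a) \<Rightarrow> 'x magma \<Rightarrow> 'a" where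
  "evm f \<equiv> eval_magma (\<cdot>) f"

lemma A_eval_degree3: "length (leaves s) \<ge> 3 \<Longrightarrow> A (evm f s) y z = 0"
proof (cases s)
  case (App p q)
  moreover assume "length (leaves s) \<ge> 3"
  ultimately have "Suc 0 < length (leaves p) \<or> Suc 0 < length (leaves q)"
    by auto
  then show ?thesis
    using App by (auto simp: length_leaves_App A_degree5)
qed simp

lemma A_eval_zero:
  assumes "length (leaves s) + length (leaves t) + length (leaves u) \<ge> 5"
  shows "A (evm f s) (evm f t) (evm f u) = 0"
proof -
  consider "length (leaves s) \<ge> 3" | "length (leaves t) \<ge> 3" | "length (leaves u) \<ge> 3"
    | "Suc 0 < length (leaves s)" "Suc 0 < length (leaves t)"
    | "Suc 0 < length (leaves s)" "Suc 0 < length (leaves u)"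
    | "Suc 0 < length (leaves t)" "Suc 0 < length (leaves u)"
    using assms by linarith
  then show ?thesis
  proof cases
    case 1 then show ?thesis by (rule A_eval_degree3)
  next
    case 2 then show ?thesis by (simp only: A_cyclic[of "evm f s"] A_eval_degree3)
  next
    case 3 then show ?thesis by (simp only: A_cyclic[of "evm f u", symmetric] A_eval_degree3)
  next
    case 4 then show ?thesis by (auto simp: length_leaves_App A_degree5)
  next
    case 5 then show ?thesis
      by (auto simp: length_leaves_App A_degree5 A_alternating(2)[of _ "evm f u" "evm f t", symmetric]
          A_alternating(2)[of "evm f s" "evm f t" "evm f u"])
  next
    case 6 then show ?thesis
      by (auto simp: length_leaves_App A_degree5 A_cyclic[of "evm f s"])
  qed
qed

text \<open>Since associators of degree five vanish, the brackets of the right factor can be shifted to the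
  left until this factor is a single letter.\<close>

lemma eval_split_last:
  assumes "length (leaves s) + length (leaves t) \<ge> 5"
  shows "\<exists>s' x. leaves s @ leaves t = leaves s' @ [x] \<and> evm f s \<cdot> evm f t = evm f s' \<cdot> f x"
  using assms
proof (induction t arbitrary: s)
  case (Var x)
  then show ?case by auto
next
  case (App t1 t2)
  have "evm f s \<cdot> evm f (App t1 t2) = evm f (App s t1) \<cdot> evm f t2"
    using A_eval_zero[of s t1 t2 f] App.prems by (simp add: A_def)
  then show ?case
    using App.IH(2)[of "App s t1"] App.prems by simp
qed

text \<open>A monomial of degree four need not equal the left-normed word with the same leaves, but the
  difference lies in the ideal of associators and is annihilated by right multiplication.\<close>

lemma eval_degree4_mult:
  assumes "length (leaves m) = 4"
  shows "evm f m \<cdot> e = lnprod (map f (leaves m)) \<cdot> e"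
proof -
  have *: "A a b c \<cdot> d \<cdot> e = 0" "A (a \<cdot> b) c d \<cdot> e = 0" "A a (b \<cdot> c) d \<cdot> e = 0" "A a b (c \<cdot> d) \<cdot> e = 0"
      for a b c d e
    using degree4_mult_zero(2)[of a b c d e] degree4_mult_zero(3)[of a b c d e]
      degree4_mult_zero(3)[of b c a d e] degree4_mult_zero(3)[of c d a b e]
      A_alternating(1)[of a "b \<cdot> c" d] A_cyclic[of "c \<cdot> d" a b]
    by (simp_all add: right_assoc_def prod_assoc_def mult_simps)
  have 1: "a \<cdot> (b \<cdot> c) \<cdot> d \<cdot> e = a \<cdot> b \<cdot> c \<cdot> d \<cdot> e" for a b c d e
    using *(1)[of a b c d e] by (simp add: A_def mult_simps)
  have 2: "a \<cdot> b \<cdot> (c \<cdot> d) \<cdot> e = a \<cdot> b \<cdot> c \<cdot> d \<cdot> e" for a b c d e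
    using *(2)[of a b c d e] by (simp add: A_def mult_simps)
  have 3: "a \<cdot> (b \<cdot> c \<cdot> d) \<cdot> e = a \<cdot> b \<cdot> c \<cdot> d \<cdot> e" for a b c d e
    using *(3)[of a b c d e] 1[of a b c d e] by (simp add: A_def mult_simps)
  have 4: "a \<cdot> (b \<cdot> (c \<cdot> d)) \<cdot> e = a \<cdot> b \<cdot> c \<cdot> d \<cdot> e" for a b c d e
    using *(4)[of a b c d e] 2[of a b c d e] by (simp add: A_def mult_simps)
  have "length (leaves m) \<le> 4"
    using assms by simp
  then show ?thesis
    by (cases rule: length_leaves_cases) (use assms in \<open>auto simp: lnprod_def 1 2 3 4\<close>)
qed

lemma eval_degree5:
  assumes "length (leaves m) \<ge> 5"
  shows "evm f m = lnprod (map f (leaves m))"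
  using assms
proof (induction "length (leaves m)" arbitrary: m rule: less_induct)
  case less
  obtain s t where m: "m = App s t"
    using less.prems length_leaves_App[of m] by auto
  obtain s' x where s': "leaves s @ leaves t = leaves s' @ [x]" "evm f s \<cdot> evm f t = evm f s' \<cdot> f x"
    using eval_split_last[of s t f] less.prems m by auto
  have len: "length (leaves m) = Suc (length (leaves s'))"
    using arg_cong[OF s'(1), of length] by (simp add: m)
  have "evm f s' \<cdot> f x = lnprod (map f (leaves s')) \<cdot> f x"
  proof (cases "length (leaves s') \<ge> 5")
    case True
    then show ?thesis using less.hyps[of s'] len by simp
  next
    case False
    then show ?thesis using len less.prems by (intro eval_degree4_mult) simp
  qed
  then show ?case
    using lnprod_snoc[of "map f (leaves s')" "f x"] by (simp add: m s')
qed

section \<open>A subspace that contains every monomial\<close>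

definition alt3 :: "('a \<Rightarrow> 'a \<Rightarrow> 'a \<Rightarrow> 'a) \<Rightarrow> bool" where
  "alt3 f \<longleftrightarrow> (\<forall>a b c. f b a c = - f a b c \<and> f a c b = - f a b c)"

lemma alt3_A: "alt3 A" and alt3_tail_swap: "alt3 tail_swap"
  unfolding alt3_def using A_alternating tail_swap_alternating by blast+

lemma alt3_repeat: "alt3 F \<Longrightarrow> F a a b = 0" "alt3 F \<Longrightarrow> F a b b = 0"
  unfolding alt3_def by (rule eq_neg_self, blast)+

lemma alt4_repeat: "alt4 F \<Longrightarrow> F a a b c = 0" "alt4 F \<Longrightarrow> F a b b c = 0" "alt4 F \<Longrightarrow> F a b c c = 0"
  unfolding alt4_def by (rule eq_neg_self, blast)+

text \<open>An alternating function is determined up to sign by its values at increasing indices, and it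
  vanishes if two indices coincide.\<close>

lemma alt3_sorted:
  fixes f :: "nat \<Rightarrow> 'a"
  assumes alt: "alt3 F" and U: "subspace U"
    and sorted: "\<And>i j k. i < j \<Longrightarrow> j < k \<Longrightarrow> F (f i) (f j) (f k) \<in> U"
  shows "F (f i) (f j) (f k) \<in> U"
proof -
  \<comment> \<open>Membership as a property of all lists, true by default except at length three.\<close>
  define P where "P is \<longleftrightarrow> (length is = 3 \<longrightarrow> F (f (is ! 0)) (f (is ! 1)) (f (is ! 2)) \<in> U)" for "is"
  have swap: "F b a c \<in> U \<longleftrightarrow> F a b c \<in> U" "F a c b \<in> U \<longleftrightarrow> F a b c \<in> U" for a b c
    using alt subspace_neg[OF U] unfolding alt3_def by (metis minus_minus)+
  have "P [i, j, k] = P (sort [i, j, k])"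
  proof (rule swap_invariant)
    fix us vs and b c :: nat
    show "P (us @ b # c # vs) = P (us @ c # b # vs)"
    proof (cases us)
      case Nil
      then show ?thesis by (simp add: P_def swap(1))
    next
      case (Cons u us')
      then show ?thesis by (cases us') (simp_all add: P_def numeral_2_eq_2 swap(2))
    qed
  qed simp
  moreover have "P is" if s: "sorted is" for "is"
    unfolding P_def
  proof
    assume "length is = 3"
    then obtain i j k where "is": "is = [i, j, k]"
      by (auto simp: numeral_3_eq_3 length_Suc_conv)
    then have "i \<le> j" "j \<le> k"
      using s by auto
    then show "F (f (is ! 0)) (f (is ! 1)) (f (is ! 2)) \<in> U"
      using sorted[of i j k] alt3_repeat[OF alt] subspace_0[OF U]
      by (cases "i = j"; cases "j = k") (simp_all add: "is")
  qed
  ultimately have "P [i, j, k]"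
    by simp
  then show ?thesis
    by (simp add: P_def)
qed

lemma alt4_sorted:
  fixes f :: "nat \<Rightarrow> 'a"
  assumes alt: "alt4 F" and U: "subspace U"
    and sorted: "\<And>i j k l. i < j \<Longrightarrow> j < k \<Longrightarrow> k < l \<Longrightarrow> F (f i) (f j) (f k) (f l) \<in> U"
  shows "F (f i) (f j) (f k) (f l) \<in> U"
proof -
  define P where "P is \<longleftrightarrow>
    (length is = 4 \<longrightarrow> F (f (is ! 0)) (f (is ! 1)) (f (is ! 2)) (f (is ! 3)) \<in> U)" for "is"
  have swap: "F b a c d \<in> U \<longleftrightarrow> F a b c d \<in> U" "F a c b d \<in> U \<longleftrightarrow> F a b c d \<in> U"
    "F a b d c \<in> U \<longleftrightarrow> F a b c d \<in> U" for a b c d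
    using alt subspace_neg[OF U] unfolding alt4_def by (metis minus_minus)+
  have "P [i, j, k, l] = P (sort [i, j, k, l])"
  proof (rule swap_invariant)
    fix us vs and b c :: nat
    show "P (us @ b # c # vs) = P (us @ c # b # vs)"
    proof (cases us)
      case Nil
      then show ?thesis by (simp add: P_def swap(1))
    next
      case (Cons u us')
      show ?thesis
      proof (cases us')
        case Nil
        then show ?thesis
          using Cons by (simp add: P_def numeral_eq_Suc swap(2))
      next
        case (Cons u' us'')
        with \<open>us = u # us'\<close> show ?thesis
          by (cases us'') (simp_all add: P_def numeral_eq_Suc swap(3))
      qed
    qed
  qed simp
  moreover have "P is" if s: "sorted is" for "is"
    unfolding P_def
  proof
    assume "length is = 4"
    then obtain i j k l where "is": "is = [i, j, k, l]"
      by (auto simp: numeral_eq_Suc length_Suc_conv)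
    then have "i \<le> j" "j \<le> k" "k \<le> l"
      using s by auto
    then show "F (f (is ! 0)) (f (is ! 1)) (f (is ! 2)) (f (is ! 3)) \<in> U"
      using sorted[of i j k l] alt4_repeat[OF alt] subspace_0[OF U]
      by (cases "i = j"; cases "j = k"; cases "k = l") (simp_all add: "is" numeral_3_eq_3)
  qed
  ultimately have "P [i, j, k, l]"
    by simp
  then show ?thesis
    by (simp add: P_def numeral_3_eq_3)
qed

lemma alt4_tail_swap_product: "alt4 (\<lambda>a b. tail_swap (a \<cdot> b))"
  unfolding alt4_def tail_swap_product
proof (intro allI conjI)
  note prod_assoc = alt4D[OF alt4_prod_assoc] and left_assoc = alt4D[OF alt4_left_assoc]
  fix a b c d
  show "prod_assoc b a c d + prod_assoc b a c d - left_assoc b a c d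
      = - (prod_assoc a b c d + prod_assoc a b c d - left_assoc a b c d)"
    by (simp add: prod_assoc(1)[of b a c d] left_assoc(1)[of b a c d])
  show "prod_assoc a c b d + prod_assoc a c b d - left_assoc a c b d
      = - (prod_assoc a b c d + prod_assoc a b c d - left_assoc a b c d)"
    by (simp add: prod_assoc(2)[of a c b d] left_assoc(2)[of a c b d])
  show "prod_assoc a b d c + prod_assoc a b d c - left_assoc a b d c
      = - (prod_assoc a b c d + prod_assoc a b c d - left_assoc a b c d)"
    by (simp add: prod_assoc(3)[of a b d c] left_assoc(3)[of a b d c])
qed

text \<open>The hypotheses list the proposed basis. The differences between the exceptional words and the
  left-normed words of the same content are values of \<open>tail_swap\<close> and \<open>A\<close> in degree three, and of
  \<open>tail_swap (ab) c d\<close> and \<open>right_assoc\<close> in degree four. By alternation all values of these functions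
  at generators lie in the subspace, hence so do those of \<open>left_assoc\<close> and \<open>prod_assoc\<close>, and with
  them every correction term of a rearrangement.\<close>

lemma eval_in_subspace:
  fixes f :: "nat \<Rightarrow> 'a"
  assumes U: "subspace U"
    and left_normed: "\<And>i js. sorted js \<Longrightarrow> foldl (\<cdot>) (f i) (map f js) \<in> U"
    and swapped3: "\<And>i j k. i < j \<Longrightarrow> j < k \<Longrightarrow> f i \<cdot> f k \<cdot> f j \<in> U"
    and right3: "\<And>i j k. i < j \<Longrightarrow> j < k \<Longrightarrow> f k \<cdot> (f i \<cdot> f j) \<in> U"
    and swapped4: "\<And>i j k l. i < j \<Longrightarrow> j < k \<Longrightarrow> k < l \<Longrightarrow> f i \<cdot> f j \<cdot> f l \<cdot> f k \<in> U"
    and right4: "\<And>i j k l. i < j \<Longrightarrow> j < k \<Longrightarrow> k < l \<Longrightarrow> f k \<cdot> (f i \<cdot> f j) \<cdot> f l \<in> U"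
  shows "evm f m \<in> U"
proof -
  note closed = subspace_add[OF U] subspace_diff[OF U] subspace_scale[OF U] subspace_neg[OF U]
      subspace_0[OF U]
  have tail_swap3: "tail_swap (f i) (f j) (f k) \<in> U" for i j k
  proof (rule alt3_sorted[OF alt3_tail_swap U])
    show "tail_swap (f i) (f j) (f k) \<in> U" if "i < j" "j < k" for i j k
      using left_normed[of "[j, k]" i] swapped3[OF that] that by (simp add: tail_swap_def closed)
  qed
  have A3: "A (f i) (f j) (f k) \<in> U" for i j k
  proof (rule alt3_sorted[OF alt3_A U])
    show "A (f i) (f j) (f k) \<in> U" if "i < j" "j < k" for i j k
    proof -
      have "A (f k) (f i) (f j) \<in> U"
        using left_normed[of "[i, j]" k] right3[OF that] that by (simp add: A_def closed)
      then show ?thesis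
        by (simp only: A_cyclic[of "f k" "f i" "f j"])
    qed
  qed
  have right_assoc4: "right_assoc (f i) (f j) (f k) (f l) \<in> U" for i j k l
  proof (rule alt4_sorted[OF alt4_right_assoc U])
    show "right_assoc (f i) (f j) (f k) (f l) \<in> U" if "i < j" "j < k" "k < l" for i j k l
    proof -
      have "A (f k) (f i) (f j) \<cdot> f l \<in> U"
        using left_normed[of "[i, j, l]" k] right4[OF that] that by (simp add: A_def closed mult_simps)
      then show ?thesis
        by (simp only: right_assoc_def A_cyclic[of "f k" "f i" "f j"])
    qed
  qed
  have tail_swap4: "tail_swap (f i \<cdot> f j) (f k) (f l) \<in> U" for i j k l
  proof (rule alt4_sorted[OF alt4_tail_swap_product U])
    show "tail_swap (f i \<cdot> f j) (f k) (f l) \<in> U" if "i < j" "j < k" "k < l" for i j k l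
      using left_normed[of "[j, k, l]" i] swapped4[OF that] that by (simp add: tail_swap_def closed)
  qed
  \<comment> \<open>Eliminating \<open>prod_assoc\<close> from \<open>tail_swap_product\<close> by \<open>triple_prod_assoc\<close> leaves \<open>left_assoc\<close>.\<close>
  have left_assoc4: "left_assoc (f i) (f j) (f k) (f l) \<in> U" for i j k l
  proof -
    let ?l = "left_assoc (f i) (f j) (f k) (f l)" and ?r = "right_assoc (f i) (f j) (f k) (f l)"
      and ?m = "prod_assoc (f i) (f j) (f k) (f l)" and ?w = "tail_swap (f i \<cdot> f j) (f k) (f l)"
    have "?w + ?w + ?w = (?m + ?m + ?m) + (?m + ?m + ?m) - (?l + ?l + ?l)"
      by (simp add: tail_swap_product algebra_simps)
    also have "\<dots> = (?l + ?r) + (?l + ?r) - (?l + ?l + ?l)"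
      by (simp only: triple_prod_assoc)
    finally have "?l = (?r + ?r) - (?w + ?w + ?w)"
      by simp
    then show ?thesis
      using right_assoc4 tail_swap4 by (simp add: closed)
  qed
  have prod_assoc4: "prod_assoc (f i) (f j) (f k) (f l) \<in> U" for i j k l
  proof -
    let ?m = "prod_assoc (f i) (f j) (f k) (f l)"
    have "scale 3 ?m = ?m + ?m + ?m"
      using scale_left_distrib[of 2 1 ?m] scale_left_distrib[of 1 1 ?m] by simp
    then have "scale 3 ?m \<in> U"
      using left_assoc4 right_assoc4 by (simp add: triple_prod_assoc closed)
    then have "scale (1 / 3) (scale 3 ?m) \<in> U"
      by (rule closed)
    then show ?thesis by simp
  qed
  have tail_swap_mult4: "tail_swap (f i) (f j) (f k) \<cdot> f l \<in> U" for i j k l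
    by (simp add: tail_swap_mult closed left_assoc4 right_assoc4 prod_assoc4)

  have words: "foldl (\<cdot>) (f i) (map f js) \<in> U" for i js
  proof -
    have "(foldl (\<cdot>) (f i) (map f js) \<in> U) = (foldl (\<cdot>) (f i) (map f (sort js)) \<in> U)"
    proof (rule swap_invariant[of js "sort js" "\<lambda>js. foldl (\<cdot>) (f i) (map f js) \<in> U"])
      fix us vs b c
      let ?d = "foldl (\<cdot>) (tail_swap (foldl (\<cdot>) (f i) (map f us)) (f b) (f c)) (map f vs)"
      have "?d \<in> U"
      proof (cases "length us + length vs \<ge> 2")
        case True
        then show ?thesis
          using foldl_tail_swap_zero[of "map f us" "map f vs"] closed by simp
      next
        case False
        then consider "us = []" "vs = []" | u where "us = [u]" "vs = []" | v where "us = []" "vs = [v]"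
          by (cases us; cases vs) (auto simp: Suc_le_eq)
        then show ?thesis
          by cases (simp_all add: tail_swap3 tail_swap4 tail_swap_mult4)
      qed
      then show "(foldl (\<cdot>) (f i) (map f (us @ b # c # vs)) \<in> U)
          = (foldl (\<cdot>) (f i) (map f (us @ c # b # vs)) \<in> U)"
        using foldl_tail_swap[of "f i" "map f us" "f b" "f c" "map f vs"] closed
        by (metis (no_types, lifting) add_diff_cancel_left' diff_add_cancel list.simps(9) map_append)
    qed simp
    then show ?thesis
      using left_normed by simp
  qed
  have w2: "f x \<cdot> f y \<in> U" and w3: "f x \<cdot> f y \<cdot> f z \<in> U" and w4: "f x \<cdot> f y \<cdot> f z \<cdot> f w \<in> U" for x y z w
    using words[of x "[y]"] words[of x "[y, z]"] words[of x "[y, z, w]"] by simp_all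
  have r3: "f x \<cdot> (f y \<cdot> f z) \<in> U" for x y z
    using closed(2)[OF w3[of x y z] A3[of x y z]] by (simp add: A_def)
  have rr: "A (f x) (f y \<cdot> f z) (f w) \<in> U" "A (f x) (f y) (f z \<cdot> f w) \<in> U" for x y z w
    using closed(4)[OF prod_assoc4[of y z x w]] prod_assoc4[of z w x y] A_alternating(1)[of "f x"
        "f y \<cdot> f z" "f w"]
      A_cyclic[of "f z \<cdot> f w" "f x" "f y"] by (simp_all add: prod_assoc_def)
  have a: "f x \<cdot> (f y \<cdot> f z) \<cdot> f w \<in> U" for x y z w
    using closed(2)[OF w4[of x y z w] right_assoc4[of x y z w]]
        by (simp add: A_def right_assoc_def mult_simps)
  have b: "f x \<cdot> f y \<cdot> (f z \<cdot> f w) \<in> U" for x y z w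
    using closed(2)[OF w4[of x y z w] prod_assoc4[of x y z w]] by (simp add: A_def prod_assoc_def)
  have c: "f x \<cdot> (f y \<cdot> f z \<cdot> f w) \<in> U" for x y z w
    using closed(2)[OF a[of x y z w] rr(1)[of x y z w]] by (simp add: A_def)
  have d: "f x \<cdot> (f y \<cdot> (f z \<cdot> f w)) \<in> U" for x y z w
    using closed(2)[OF b[of x y z w] rr(2)[of x y z w]] by (simp add: A_def)
  show ?thesis
  proof (cases "length (leaves m) \<le> 4")
    case True
    then show ?thesis
      by (cases rule: length_leaves_cases) (use words[of _ "[]"] in \<open>auto simp: w2 w3 w4 r3 a b c d\<close>)
  next
    case False
    then have "evm f m = lnprod (map f (leaves m))"
      by (intro eval_degree5) simp
    also have "\<dots> = foldl (\<cdot>) (f (hd (leaves m))) (map f (tl (leaves m)))"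
      by (simp add: lnprod_def hd_map map_tl)
    finally show ?thesis
      using words by simp
  qed
qed

end

section \<open>Linear functionals and words in the free algebra\<close>

definition (in variety_algebra) lift :: "('x \<Rightarrow> 'a) \<Rightarrow> ('x, 'k) free_alg \<Rightarrow> 'a" where
  "lift f = (THE h. algebra_hom scale_free_alg (*) scale mult h \<and> (\<forall>x. h (gen x) = f x))"

lemma (in variety_algebra) lift_simps:
  "lift f (gen x) = f x" "lift f (a + b) = lift f a + lift f b"
  "lift f (scale_free_alg r a) = scale r (lift f a)" "lift f (a * b) = mult (lift f a) (lift f b)"
proof -
  have "algebra_hom scale_free_alg (*) scale mult (lift f) \<and> (\<forall>x. lift f (gen x) = f x)"
    unfolding lift_def by (rule theI'[OF free_alg_universal])
  then show "lift f (gen x) = f x" "lift f (a + b) = lift f a + lift f b"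
    "lift f (scale_free_alg r a) = scale r (lift f a)" "lift f (a * b) = mult (lift f a) (lift f b)"
    unfolding algebra_hom_def by blast+
qed

definition linear_functional :: "(('x, 'k::field) free_alg \<Rightarrow> 'k) \<Rightarrow> bool" where
  "linear_functional \<phi> \<longleftrightarrow>
    (\<forall>x y. \<phi> (x + y) = \<phi> x + \<phi> y) \<and> (\<forall>r x. \<phi> (scale_free_alg r x) = r * \<phi> x)"

text \<open>One step of a triangularity argument: the functionals for \<open>B1\<close> see nothing of \<open>B2\<close>, while those
  that make \<open>B2\<close> independent may be nonzero on \<open>B1\<close>.\<close>

lemma independent_Un_dual:
  assumes B2: "free_alg.independent B2"
    and B1: "\<And>b. b \<in> B1 \<Longrightarrow> \<exists>\<phi>. linear_functional \<phi> \<and> \<phi> b \<noteq> 0 \<and> (\<forall>b'\<in>B1 \<union> B2. b' \<noteq> b \<longrightarrow> \<phi> b' = 0)"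
  shows "free_alg.independent (B1 \<union> B2)"
  unfolding free_alg.independent_explicit_finite_subsets
proof (intro allI impI ballI)
  fix T u v
  assume T: "T \<subseteq> B1 \<union> B2" "finite T" and sum: "(\<Sum>v\<in>T. scale_free_alg (u v) v) = 0" and v: "v \<in> T"
  have zero: "u b = 0" if b: "b \<in> T" "b \<in> B1" for b
  proof -
    obtain \<phi> where \<phi>: "linear_functional \<phi>" "\<phi> b \<noteq> 0" "\<And>b'. b' \<in> B1 \<union> B2 \<Longrightarrow> b' \<noteq> b \<Longrightarrow> \<phi> b' = 0"
      using B1[OF b(2)] by blast
    have add: "\<phi> (x + y) = \<phi> x + \<phi> y" and scale: "\<phi> (scale_free_alg r x) = r * \<phi> x" for x y r
      using \<phi>(1) by (auto simp: linear_functional_def)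
    have "\<phi> 0 = 0"
      using scale[of 0 0] by simp
    then have "\<phi> (\<Sum>v\<in>S. scale_free_alg (u v) v) = (\<Sum>v\<in>S. u v * \<phi> v)" for S
      by (induction S rule: infinite_finite_induct) (auto simp: add scale)
    also have "(\<Sum>v\<in>T. u v * \<phi> v) = (\<Sum>v\<in>T. if v = b then u b * \<phi> b else 0)"
      using T(1) \<phi>(3) by (intro sum.cong refl) auto
    also have "\<dots> = u b * \<phi> b"
      using T(2) b(1) by simp
    finally show ?thesis
      using sum \<open>\<phi> 0 = 0\<close> \<phi>(2) by simp
  qed
  show "u v = 0"
  proof (cases "v \<in> B1")
    case False
    have "(\<Sum>v\<in>T. scale_free_alg (u v) v) = (\<Sum>v\<in>T \<inter> B2. scale_free_alg (u v) v)"
      using T zero by (intro sum.mono_neutral_right) auto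
    then have "(\<Sum>v\<in>T \<inter> B2. scale_free_alg (u v) v) = 0"
      using sum by simp
    moreover have "v \<in> T \<inter> B2" "finite (T \<inter> B2)" "T \<inter> B2 \<subseteq> B2"
      using v T False by auto
    ultimately show ?thesis
      using B2 unfolding free_alg.independent_explicit_finite_subsets by blast
  qed (use zero v in blast)
qed

definition word :: "nat \<Rightarrow> nat list \<Rightarrow> (nat, 'k::field) free_alg" where
  "word a bs = left_normed (gen a) (map gen bs)"

lemma word_simps: "word a [] = gen a" "word a (bs @ [b]) = word a bs * gen b"
  by (simp_all add: word_def left_normed_def)

lemma word_short: "word a [b] = gen a * gen b" "word a [b, c] = gen a * gen b * gen c"
  "word a [b, c, d] = gen a * gen b * gen c * gen d"
  by (simp_all add: word_def left_normed_def)

section \<open>The model with commuting tails\<close>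

text \<open>The polynomials in commuting variables, as the monoid algebra of the multisets of variables.\<close>

type_synonym 'k mon_alg = "nat multiset \<Rightarrow>\<^sub>0 'k"

definition perm_scale :: "'k::field \<Rightarrow> 'k mon_alg \<times> 'k mon_alg \<Rightarrow> 'k mon_alg \<times> 'k mon_alg" where
  "perm_scale r = (\<lambda>(u, p). (Poly_Mapping.single 0 r * u, Poly_Mapping.single 0 r * p))"

definition perm_mult :: "'k::field mon_alg \<times> 'k mon_alg \<Rightarrow> 'k mon_alg \<times> 'k mon_alg \<Rightarrow> 'k mon_alg
    \<times> 'k mon_alg" where
  "perm_mult = (\<lambda>(u, p) (v, q). (u * q, p * q))"

interpretation perm: variety_algebra perm_scale perm_mult
  by unfold_locales
    (auto simp: perm_scale_def perm_mult_def associator_def plus_prod_def zero_prod_def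
      single_add mult_single algebra_simps)

text \<open>The first component keeps only the words that start with the generator \<open>i\<close>, and then it lists
  their tails; the second component is the abelianization.\<close>

definition perm_eval :: "nat \<Rightarrow> (nat, 'k::field) free_alg \<Rightarrow> 'k mon_alg \<times> 'k mon_alg" where
  "perm_eval i = perm.lift (\<lambda>x. (Poly_Mapping.single 0 (of_bool (x = i)), Poly_Mapping.single {#x#} 1))"

lemmas perm_eval_simps = perm.lift_simps[where f = "\<lambda>x. (Poly_Mapping.single 0 (of_bool (x = i)),
  Poly_Mapping.single {#x#} 1)" for i, folded perm_eval_def]

definition perm_coeff :: "nat \<Rightarrow> nat multiset \<Rightarrow> (nat, 'k::field) free_alg \<Rightarrow> 'k" where
  "perm_coeff i M v = Poly_Mapping.lookup (fst (perm_eval i v)) M"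

lemma linear_functional_perm_coeff: "linear_functional (perm_coeff i M)"
proof -
  have "Poly_Mapping.lookup (Poly_Mapping.single 0 r * u) M = r * Poly_Mapping.lookup u M"
    for r :: 'a and u
    by (simp add: mult_map_scale_conv_mult[symmetric] map.rep_eq when_def)
  then show ?thesis
    by (simp add: linear_functional_def perm_coeff_def perm_eval_simps lookup_add perm_scale_def
        split: prod.split)
qed

lemma perm_coeff_word: "perm_coeff i M (word a bs) = of_bool (a = i \<and> mset bs = M)"
proof -
  have "perm_eval i (word a bs)
      = (Poly_Mapping.single (mset bs) (of_bool (a = i) :: 'a), Poly_Mapping.single (add_mset a
          (mset bs)) 1)"
    by (induction bs rule: rev_induct)
      (simp_all add: word_simps perm_eval_simps perm_mult_def mult_single add_mset_commute)
  then show ?thesis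
    by (auto simp: perm_coeff_def lookup_single when_def)
qed

section \<open>The alternating model\<close>

text \<open>Consider the superalgebra with odd generator \<open>x\<close> and basis \<open>x\<close>, \<open>y = xx\<close>, \<open>yx\<close>, \<open>xy\<close>,
  \<open>s = (yx)x\<close>, \<open>t = (xy)x\<close>, in which \<open>yy = 2s + t\<close>, \<open>x(yx) = - s\<close>, \<open>x(xy) = 3s + 2t\<close> and all
  products of degree above four vanish; the free superalgebra of the variety on \<open>x\<close> leads to these
  constants. An element of \<open>alt_alg\<close> lists, for each of the six basis elements in this
  order, the alternating form by which it is multiplied in the Grassmann envelope.
  Forms are given by their coefficients at lists of indices. Only the coefficients at increasing
  indices matter, but the signed sums over shuffles that define the wedge products make sense, and
  satisfy the same identities, for all functions of the indices; so alternation of the forms is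
  not imposed.\<close>

type_synonym 'k alt_alg = "(nat \<Rightarrow> 'k) \<times> (nat \<Rightarrow> nat \<Rightarrow> 'k) \<times> (nat \<Rightarrow> nat \<Rightarrow> nat \<Rightarrow> 'k)
  \<times> (nat \<Rightarrow> nat \<Rightarrow> nat \<Rightarrow> 'k) \<times> (nat \<Rightarrow> nat \<Rightarrow> nat \<Rightarrow> nat \<Rightarrow> 'k) \<times> (nat \<Rightarrow> nat \<Rightarrow> nat \<Rightarrow> nat \<Rightarrow> 'k)"

definition wedge11 :: "(nat \<Rightarrow> 'k::field) \<Rightarrow> (nat \<Rightarrow> 'k) \<Rightarrow> nat \<Rightarrow> nat \<Rightarrow> 'k" where
  "wedge11 u v i j = u i * v j - u j * v i"
definition wedge21 :: "(nat \<Rightarrow> nat \<Rightarrow> 'k::field) \<Rightarrow> (nat \<Rightarrow> 'k) \<Rightarrow> nat \<Rightarrow> nat \<Rightarrow> nat \<Rightarrow> 'k" where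
  "wedge21 u v i j k = u i j * v k - u i k * v j + u j k * v i"
definition wedge12 :: "(nat \<Rightarrow> 'k::field) \<Rightarrow> (nat \<Rightarrow> nat \<Rightarrow> 'k) \<Rightarrow> nat \<Rightarrow> nat \<Rightarrow> nat \<Rightarrow> 'k" where
  "wedge12 u v i j k = u i * v j k - u j * v i k + u k * v i j"
definition wedge31 :: "(nat \<Rightarrow> nat \<Rightarrow> nat \<Rightarrow> 'k::field) \<Rightarrow> (nat \<Rightarrow> 'k) \<Rightarrow> nat \<Rightarrow> nat \<Rightarrow> nat \<Rightarrow> nat \<Rightarrow> 'k" where
  "wedge31 u v i j k l = u i j k * v l - u i j l * v k + u i k l * v j - u j k l * v i"
definition wedge13 :: "(nat \<Rightarrow> 'k::field) \<Rightarrow> (nat \<Rightarrow> nat \<Rightarrow> nat \<Rightarrow> 'k) \<Rightarrow> nat \<Rightarrow> nat \<Rightarrow> nat \<Rightarrow> nat \<Rightarrow> 'k" where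
  "wedge13 u v i j k l = u i * v j k l - u j * v i k l + u k * v i j l - u l * v i j k"
definition wedge22 :: "(nat \<Rightarrow> nat \<Rightarrow> 'k::field) \<Rightarrow> (nat \<Rightarrow> nat \<Rightarrow> 'k) \<Rightarrow> nat \<Rightarrow> nat \<Rightarrow> nat \<Rightarrow> nat \<Rightarrow> 'k" where
  "wedge22 u v i j k l = u i j * v k l - u i k * v j l + u i l * v j k
     + u j k * v i l - u j l * v i k + u k l * v i j"
lemmas wedge_defs = wedge11_def wedge21_def wedge12_def wedge31_def wedge13_def wedge22_def

definition alt_scale :: "'k::field \<Rightarrow> 'k alt_alg \<Rightarrow> 'k alt_alg" where
  "alt_scale r = (\<lambda>(a, b, c, d, e, f). (\<lambda>i. r * a i, \<lambda>i j. r * b i j, \<lambda>i j k. r * c i j k,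
    \<lambda>i j k. r * d i j k, \<lambda>i j k l. r * e i j k l, \<lambda>i j k l. r * f i j k l))"

definition alt_mult :: "'k::field alt_alg \<Rightarrow> 'k alt_alg \<Rightarrow> 'k alt_alg" where
  "alt_mult = (\<lambda>(a, b, c, d, e, f) (a', b', c', d', e', f').
    (\<lambda>i. 0, wedge11 a a', wedge21 b a', wedge12 a b',
     \<lambda>i j k l. wedge31 c a' i j k l + 2 * wedge22 b b' i j k l - wedge13 a c' i j k l
         + 3 * wedge13 a d' i j k l,
     \<lambda>i j k l. wedge31 d a' i j k l + wedge22 b b' i j k l + 2 * wedge13 a d' i j k l))"

interpretation alt: variety_algebra alt_scale alt_mult
proof
  fix a b c :: "'k::field alt_alg"
  show "associator alt_mult a b c + associator alt_mult a c b = 0"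
    by (cases a; cases b; cases c)
      (simp add: associator_def alt_mult_def plus_prod_def minus_prod_def zero_prod_def fun_eq_iff
          wedge_defs algebra_simps)
  show "associator alt_mult a b c + associator alt_mult b a c = 0"
    by (cases a; cases b; cases c)
      (simp add: associator_def alt_mult_def plus_prod_def minus_prod_def zero_prod_def fun_eq_iff
          wedge_defs algebra_simps)
  show "alt_mult (alt_mult a b) c + alt_mult (alt_mult c b) a
      = alt_mult (alt_mult a c) b + alt_mult (alt_mult c a) b"
    by (cases a; cases b; cases c)
      (simp add: alt_mult_def plus_prod_def fun_eq_iff wedge_defs algebra_simps)
qed (auto simp: alt_scale_def alt_mult_def plus_prod_def zero_prod_def fun_eq_iff wedge_defs
    algebra_simps)

definition det2 :: "nat \<Rightarrow> nat \<Rightarrow> nat \<Rightarrow> nat \<Rightarrow> 'k::field" where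
  "det2 i j a b = of_bool (a = i \<and> b = j) - of_bool (a = j \<and> b = i)"

definition det3 :: "nat \<Rightarrow> nat \<Rightarrow> nat \<Rightarrow> nat \<Rightarrow> nat \<Rightarrow> nat \<Rightarrow> 'k::field" where
  "det3 i j k a b c =
    of_bool (a = i) * det2 j k b c - of_bool (a = j) * det2 i k b c + of_bool (a = k) * det2 i j b c"

definition det4 :: "nat \<Rightarrow> nat \<Rightarrow> nat \<Rightarrow> nat \<Rightarrow> nat \<Rightarrow> nat \<Rightarrow> nat \<Rightarrow> nat \<Rightarrow> 'k::field" where
  "det4 i j k l a b c d =
    of_bool (a = i) * det3 j k l b c d - of_bool (a = j) * det3 i k l b c d
    + of_bool (a = k) * det3 i j l b c d - of_bool (a = l) * det3 i j k b c d"

definition alt_eval :: "(nat, 'k::field) free_alg \<Rightarrow> 'k alt_alg" where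
  "alt_eval = alt.lift (\<lambda>x. (\<lambda>i. of_bool (x = i), \<lambda>_ _. 0, \<lambda>_ _ _. 0, \<lambda>_ _ _. 0, \<lambda>_ _ _ _. 0, \<lambda>_ _ _ _.
      0))"

lemmas alt_eval_hom = alt.lift_simps[where f = "\<lambda>x. (\<lambda>i. of_bool (x = i), \<lambda>_ _. 0, \<lambda>_ _ _. 0,
  \<lambda>_ _ _. 0, \<lambda>_ _ _ _. 0, \<lambda>_ _ _ _. 0)", folded alt_eval_def]

text \<open>The coefficients of \<open>yx\<close>, \<open>xy\<close>, \<open>s\<close> and \<open>t\<close>. Left-normed words have no \<open>xy\<close> and no \<open>t\<close> component, so
  that \<open>right_coeff3\<close> and \<open>right_coeff4\<close> isolate the words that are not left-normed.\<close>

definition left_coeff3 :: "nat \<Rightarrow> nat \<Rightarrow> nat \<Rightarrow> (nat, 'k::field) free_alg \<Rightarrow> 'k" where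
  "left_coeff3 i j k v = fst (snd (snd (alt_eval v))) i j k"
definition right_coeff3 :: "nat \<Rightarrow> nat \<Rightarrow> nat \<Rightarrow> (nat, 'k::field) free_alg \<Rightarrow> 'k" where
  "right_coeff3 i j k v = fst (snd (snd (snd (alt_eval v)))) i j k"
definition left_coeff4 :: "nat \<Rightarrow> nat \<Rightarrow> nat \<Rightarrow> nat \<Rightarrow> (nat, 'k::field) free_alg \<Rightarrow> 'k" where
  "left_coeff4 i j k l v = fst (snd (snd (snd (snd (alt_eval v))))) i j k l"
definition right_coeff4 :: "nat \<Rightarrow> nat \<Rightarrow> nat \<Rightarrow> nat \<Rightarrow> (nat, 'k::field) free_alg \<Rightarrow> 'k" where
  "right_coeff4 i j k l v = snd (snd (snd (snd (snd (alt_eval v))))) i j k l"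
lemmas coeff_defs = left_coeff3_def right_coeff3_def left_coeff4_def right_coeff4_def

lemma linear_functional_coeff:
  "linear_functional (left_coeff3 i j k)" "linear_functional (right_coeff3 i j k)"
  "linear_functional (left_coeff4 i j k l)" "linear_functional (right_coeff4 i j k l)"
  by (simp_all add: linear_functional_def coeff_defs alt_eval_hom alt_scale_def
      split: prod.split)

text \<open>The wedge product of coordinate functions is a determinant of Kronecker deltas.\<close>

lemma wedge_det:
  fixes a b c d :: nat
  shows "wedge11 (\<lambda>m. of_bool (a = m)) (\<lambda>m. of_bool (b = m)) = (\<lambda>i j. det2 i j a b :: 'k::field)"
    and "wedge21 (\<lambda>i j. det2 i j a b) (\<lambda>m. of_bool (c = m)) = (\<lambda>i j k. det3 i j k a b c :: 'k)"
    and "wedge12 (\<lambda>m. of_bool (a = m)) (\<lambda>i j. det2 i j b c) = (\<lambda>i j k. det3 i j k a b c :: 'k)"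
    and "wedge31 (\<lambda>i j k. det3 i j k a b c) (\<lambda>m. of_bool (d = m))
        = (\<lambda>i j k l. det4 i j k l a b c d :: 'k)"
proof -
  show "wedge11 (\<lambda>m. of_bool (a = m)) (\<lambda>m. of_bool (b = m)) = (\<lambda>i j. det2 i j a b :: 'k)"
    by (auto simp: fun_eq_iff wedge11_def det2_def)
  show "wedge21 (\<lambda>i j. det2 i j a b) (\<lambda>m. of_bool (c = m)) = (\<lambda>i j k. det3 i j k a b c :: 'k)"
    by (simp add: fun_eq_iff wedge21_def det3_def det2_def of_bool_conj algebra_simps)
  show "wedge12 (\<lambda>m. of_bool (a = m)) (\<lambda>i j. det2 i j b c) = (\<lambda>i j k. det3 i j k a b c :: 'k)"
    by (simp add: fun_eq_iff wedge12_def det3_def)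
  show "wedge31 (\<lambda>i j k. det3 i j k a b c) (\<lambda>m. of_bool (d = m))
      = (\<lambda>i j k l. det4 i j k l a b c d :: 'k)"
    by (simp add: fun_eq_iff wedge31_def det4_def det3_def det2_def of_bool_conj algebra_simps)
qed

lemma wedge_0:
  fixes v :: "nat \<Rightarrow> 'k::field"
  shows "wedge11 (\<lambda>_. 0) v = (\<lambda>_ _. 0)" "wedge12 (\<lambda>_. 0) x = (\<lambda>_ _ _. 0)" "wedge12 v (\<lambda>_ _. 0)
      = (\<lambda>_ _ _. 0)"
    "wedge21 (\<lambda>_ _. 0) v = (\<lambda>_ _ _. 0)" "wedge31 (\<lambda>_ _ _. 0) v = (\<lambda>_ _ _ _. 0)"
    "wedge13 (\<lambda>_. 0) y = (\<lambda>_ _ _ _. 0)" "wedge13 v (\<lambda>_ _ _. 0) = (\<lambda>_ _ _ _. 0)"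
    "wedge22 (\<lambda>_ _. 0) x = (\<lambda>_ _ _ _. 0)" "wedge22 x (\<lambda>_ _. 0) = (\<lambda>_ _ _ _. 0)"
  by (simp_all add: fun_eq_iff wedge_defs)

lemmas alt_eval_simps = alt_eval_hom alt_mult_def wedge_det wedge_0

lemma alt_eval_long_word: "length bs \<ge> 4 \<Longrightarrow> alt_eval (word a bs) = 0"
proof (induction bs rule: rev_induct)
  case (snoc b bs)
  have step: "alt_eval (word a (bs @ [b])) = alt_mult (alt_eval (word a bs)) (alt_eval (gen b))"
    by (simp add: word_simps alt_eval_hom)
  show ?case
  proof (cases "length bs \<ge> 4")
    case True
    then show ?thesis
      unfolding step by (simp add: snoc.IH alt.mult_zero)
  next
    case False
    then have "length bs = 3"
      using snoc.prems by simp
    then obtain x y z where "bs = [x, y, z]"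
      by (auto simp: numeral_3_eq_3 length_Suc_conv)
    then show ?thesis
      unfolding step by (simp add: word_short alt_eval_simps zero_prod_def zero_fun_def)
  qed
qed simp

lemma word_length_cases:
  obtains b where "bs = [b]" | b c where "bs = [b, c]" | b c d where "bs = [b, c, d]"
  | "bs = []" | "length bs \<ge> 4"
  by (cases bs; cases "tl bs"; cases "tl (tl bs)"; cases "tl (tl (tl bs))") auto

lemma coeff_word:
  "left_coeff3 i j k (word a bs) = (case bs of [b, c] \<Rightarrow> det3 i j k a b c | _ \<Rightarrow> 0)"
  "right_coeff3 i j k (word a bs) = 0"
  "left_coeff4 i j k l (word a bs) = (case bs of [b, c, d] \<Rightarrow> det4 i j k l a b c d | _ \<Rightarrow> 0)"
  "right_coeff4 i j k l (word a bs) = 0"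
proof -
  show "left_coeff3 i j k (word a bs) = (case bs of [b, c] \<Rightarrow> det3 i j k a b c | _ \<Rightarrow> 0)"
    by (cases bs rule: word_length_cases)
      (auto simp: coeff_defs word_short word_simps(1) alt_eval_simps alt_eval_long_word
          split: list.split)
  show "right_coeff3 i j k (word a bs) = 0"
    by (cases bs rule: word_length_cases)
      (auto simp: coeff_defs word_short word_simps(1) alt_eval_simps alt_eval_long_word
          split: list.split)
  show "left_coeff4 i j k l (word a bs) = (case bs of [b, c, d] \<Rightarrow> det4 i j k l a b c d | _ \<Rightarrow> 0)"
    by (cases bs rule: word_length_cases)
      (auto simp: coeff_defs word_short word_simps(1) alt_eval_simps alt_eval_long_word
          split: list.split)
  show "right_coeff4 i j k l (word a bs) = 0"
    by (cases bs rule: word_length_cases)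
      (auto simp: coeff_defs word_short word_simps(1) alt_eval_simps alt_eval_long_word
          split: list.split)
qed

lemma coeff_right_word:
  "right_coeff3 i j k (gen a * (gen b * gen c)) = det3 i j k a b c"
  "right_coeff3 i j k (gen a * (gen b * gen c) * gen d) = 0"
  "right_coeff4 i j k l (gen a * (gen b * gen c)) = 0"
  "right_coeff4 i j k l (gen a * (gen b * gen c) * gen d) = det4 i j k l a b c d"
  by (simp_all add: coeff_defs alt_eval_simps)

section \<open>Linear independence\<close>

abbreviation (input) words :: "(nat, 'k::field) free_alg set" where
  "words \<equiv> {word a bs | a bs. sorted bs}"
abbreviation (input) swapped_words :: "(nat, 'k::field) free_alg set" where
  "swapped_words \<equiv> {word i [k, j] | i j k. i < j \<and> j < k} \<union> {word i [j, l, k] | i j k l. i < j \<and> j < k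
      \<and> k < l}"
abbreviation (input) right_words :: "(nat, 'k::field) free_alg set" where
  "right_words \<equiv> {gen k * (gen i * gen j) | i j k. i < j \<and> j < k} \<union>
    {gen k * (gen i * gen j) * gen l | i j k l. i < j \<and> j < k \<and> k < l}"

lemma linear_functional_simps:
  assumes "linear_functional \<phi>" "linear_functional \<psi>"
  shows "linear_functional (\<lambda>x. \<phi> x + \<psi> x)" "linear_functional (\<lambda>x. \<phi> x - \<psi> x)"
  using assms by (simp_all add: linear_functional_def algebra_simps)

lemma sorted_mset_eq_iff: "sorted xs \<Longrightarrow> sorted ys \<Longrightarrow> mset xs = mset ys \<longleftrightarrow> xs = ys"
  for xs ys :: "'a::linorder list"
  by (metis properties_for_sort)

lemma independent_words: "free_alg.independent (words :: (nat, 'k::field) free_alg set)"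
proof -
  have "free_alg.independent (words \<union> ({} :: (nat, 'k) free_alg set))"
  proof (rule independent_Un_dual)
    fix b :: "(nat, 'k) free_alg" assume "b \<in> words"
    then obtain i js where b: "b = word i js" "sorted js" by blast
    have "perm_coeff i (mset js) b' = 0" if "b' \<in> words" "b' \<noteq> b" for b'
      using that b by (auto simp: perm_coeff_word sorted_mset_eq_iff)
    then show "\<exists>\<phi>. linear_functional \<phi> \<and> \<phi> b \<noteq> 0 \<and> (\<forall>b'\<in>words \<union> {}. b' \<noteq> b \<longrightarrow> \<phi> b' = 0)"
      using linear_functional_perm_coeff b by (intro exI[of _ "perm_coeff i (mset js)"])
          (auto simp: perm_coeff_word)
  qed (simp add: free_alg.independent_empty)
  then show ?thesis by simp
qed

lemma det2_sorted: "j < k \<Longrightarrow> b \<le> c \<Longrightarrow> det2 j k b c = of_bool (b = j \<and> c = k)"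
  by (auto simp: det2_def)

lemma det3_sorted:
  "j < k \<Longrightarrow> k < l \<Longrightarrow> b \<le> c \<Longrightarrow> c \<le> d \<Longrightarrow>
    det3 j k l b c d = of_bool (b = j \<and> c = k \<and> d = l)"
  by (auto simp: det3_def det2_sorted)

lemma det2_swap: "det2 j k c b = - det2 j k b c"
  by (simp only: det2_def minus_diff_eq conj_commute)

lemma det3_swap: "det3 j k l b d c = - det3 j k l b c d"
  unfolding det3_def det2_swap[of k l d c] det2_swap[of j l d c] det2_swap[of j k d c] by simp

text \<open>The coefficient of \<open>yx\<close> or \<open>s\<close> is an alternating sum over the permutations of the word, so it is
  nonzero on sorted words, too. Subtracting its expansion along the head of the word, with each
  minor replaced by the functional of the commuting model, removes the sorted words; on a word
  whose last two tail letters are swapped the two terms have opposite signs and add up.\<close>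

lemma independent_swapped_words:
  "free_alg.independent (swapped_words \<union> words :: (nat, 'k::field_char_0) free_alg set)"
proof (rule independent_Un_dual[OF independent_words])
  define D3 where "D3 i j k x = (left_coeff3 i j k x :: 'k) - perm_coeff i (mset [j, k]) x
      + perm_coeff j (mset [i, k]) x - perm_coeff k (mset [i, j]) x" for i j k x
  define D4 where "D4 i j k l x = (left_coeff4 i j k l x :: 'k) - perm_coeff i (mset [j, k, l]) x
      + perm_coeff j (mset [i, k, l]) x
    - perm_coeff k (mset [i, j, l]) x + perm_coeff l (mset [i, j, k]) x" for i j k l x
  define e2 where "e2 j k b c = (det2 j k b c - of_bool (mset [b, c] = mset [j, k]) :: 'k)" for j k b c
  define e3 where "e3 j k l b c d = (det3 j k l b c d - of_bool (mset [b, c, d]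
      = mset [j, k, l]) :: 'k)" for j k l b c d
  have len: "mset bs \<noteq> mset ks" if "length bs \<noteq> length ks" for bs ks :: "nat list"
    using that mset_eq_length by blast
  have D3_word: "D3 i j k (word a bs) = (case bs of [b, c] \<Rightarrow>
      of_bool (a = i) * e2 j k b c - of_bool (a = j) * e2 i k b c + of_bool (a = k) * e2 i j b c
          | _ \<Rightarrow> 0)"
    for i j k a bs
  proof (cases "\<exists>b c. bs = [b, c]")
    case True
    then obtain b c where bs: "bs = [b, c]"
      by blast
    show ?thesis
      unfolding D3_def coeff_word perm_coeff_word bs of_bool_conj
      by (simp add: e2_def det3_def algebra_simps del: mset.simps)
  next
    case False
    then have "length bs \<noteq> 2"
      by (auto simp: numeral_2_eq_2 length_Suc_conv)
    moreover have "(case bs of [b, c] \<Rightarrow> F b c | _ \<Rightarrow> 0) = 0" for F :: "nat \<Rightarrow> nat \<Rightarrow> 'k"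
      using False by (auto split: list.split)
    ultimately show ?thesis
      by (simp add: D3_def coeff_word perm_coeff_word len del: mset.simps)
  qed
  have D4_word: "D4 i j k l (word a bs) = (case bs of [b, c, d] \<Rightarrow>
      of_bool (a = i) * e3 j k l b c d - of_bool (a = j) * e3 i k l b c d
      + of_bool (a = k) * e3 i j l b c d - of_bool (a = l) * e3 i j k b c d | _ \<Rightarrow> 0)" for i j k l a bs
  proof (cases "\<exists>b c d. bs = [b, c, d]")
    case True
    then obtain b c d where bs: "bs = [b, c, d]"
      by blast
    show ?thesis
      unfolding D4_def coeff_word perm_coeff_word bs of_bool_conj
      by (simp add: e3_def det4_def algebra_simps del: mset.simps)
  next
    case False
    then have "length bs \<noteq> 3"
      by (auto simp: numeral_3_eq_3 length_Suc_conv)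
    moreover have "(case bs of [b, c, d] \<Rightarrow> F b c d | _ \<Rightarrow> 0) = 0" for F :: "nat \<Rightarrow> nat \<Rightarrow> nat \<Rightarrow> 'k"
      using False by (auto split: list.split)
    ultimately show ?thesis
      by (simp add: D4_def coeff_word perm_coeff_word len del: mset.simps)
  qed
  have e2_sorted: "e2 j k b c = 0" if "j < k" "b \<le> c" for j k b c
    using that by (simp add: e2_def det2_sorted sorted_mset_eq_iff del: mset.simps)
  have e3_sorted: "e3 j k l b c d = 0" if "j < k" "k < l" "b \<le> c" "c \<le> d" for j k l b c d
    using that by (simp add: e3_def det3_sorted sorted_mset_eq_iff del: mset.simps)
  have e2_swapped: "e2 j k c b = - 2 * of_bool (b = j \<and> c = k)" if "j < k" "b < c" for j k b c
  proof -
    have "mset [c, b] = mset [b, c]" by simp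
    then show ?thesis
      using that by (simp add: e2_def det2_swap[of _ _ c b] det2_sorted sorted_mset_eq_iff del:
          mset.simps)
  qed
  have e3_swapped: "e3 j k l b d c = - 2 * of_bool (b = j \<and> c = k \<and> d = l)"
      if "j < k" "k < l" "b < c" "c < d" for j k l b c d
  proof -
    have "mset [b, d, c] = mset [b, c, d]" by simp
    then show ?thesis
      using that by (simp add: e3_def det3_swap[of _ _ _ _ d c] det3_sorted sorted_mset_eq_iff del:
          mset.simps)
  qed
  fix b :: "(nat, 'k) free_alg" assume "b \<in> swapped_words"
  then consider i j k where "b = word i [k, j]" "i < j" "j < k"
    | i j k l where "b = word i [j, l, k]" "i < j" "j < k" "k < l"
    by blast
  then show "\<exists>\<phi>. linear_functional \<phi> \<and> \<phi> b \<noteq> 0 \<and> (\<forall>b'\<in>swapped_words \<union> words. b' \<noteq> b \<longrightarrow> \<phi> b' = 0)"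
  proof cases
    case (1 i j k)
    have "linear_functional (D3 i j k)"
      unfolding D3_def by (intro linear_functional_simps linear_functional_perm_coeff
        linear_functional_coeff)
    moreover have "D3 i j k b \<noteq> 0"
      using 1 by (simp add: D3_word e2_swapped)
    moreover have "D3 i j k (word a bs) = 0" if "sorted bs" for a bs
      using 1 that by (auto simp: D3_word e2_sorted split: list.split)
    moreover have "D3 i j k (word i' [k', j']) = 0" if "i' < j'" "j' < k'" "word i' [k', j'] \<noteq> b"
        for i' j' k'
      using 1 that by (auto simp: D3_word e2_swapped)
    moreover have "D3 i j k (word i' [j', l', k']) = 0" for i' j' k' l'
      by (simp add: D3_word)
    ultimately show ?thesis
      by (intro exI[of _ "D3 i j k"]) blast
  next
    case (2 i j k l)
    have "linear_functional (D4 i j k l)"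
      unfolding D4_def by (intro linear_functional_simps linear_functional_perm_coeff
        linear_functional_coeff)
    moreover have "D4 i j k l b \<noteq> 0"
      using 2 by (simp add: D4_word e3_swapped)
    moreover have "D4 i j k l (word a bs) = 0" if "sorted bs" for a bs
      using 2 that by (auto simp: D4_word e3_sorted split: list.split)
    moreover have "D4 i j k l (word i' [j', l', k']) = 0"
      if "i' < j'" "j' < k'" "k' < l'" "word i' [j', l', k'] \<noteq> b" for i' j' k' l'
      using 2 that by (auto simp: D4_word e3_swapped)
    moreover have "D4 i j k l (word i' [k', j']) = 0" for i' j' k'
      by (simp add: D4_word)
    ultimately show ?thesis
      by (intro exI[of _ "D4 i j k l"]) blast
  qed
qed

lemma independent_right_words:
  "free_alg.independent (right_words \<union> (swapped_words \<union> words) :: (nat, 'k::field_char_0) free_alg set)"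
proof (rule independent_Un_dual[OF independent_swapped_words])
  have det3: "det3 i j k k' i' j' = (of_bool (i = i' \<and> j = j' \<and> k = k') :: 'k)"
    if "i < j" "j < k" "i' < j'" "j' < k'" for i j k i' j' k'
    using that by (auto simp: det3_def det2_sorted)
  have det4: "det4 i j k l k' i' j' l' = (of_bool (i = i' \<and> j = j' \<and> k = k' \<and> l = l') :: 'k)"
    if "i < j" "j < k" "k < l" "i' < j'" "j' < k'" "k' < l'" for i j k l i' j' k' l'
    using that by (auto simp: det4_def det3_sorted)
  fix b :: "(nat, 'k) free_alg" assume "b \<in> right_words"
  then consider i j k where "b = gen k * (gen i * gen j)" "i < j" "j < k"
    | i j k l where "b = gen k * (gen i * gen j) * gen l" "i < j" "j < k" "k < l"
    by blast
  then show "\<exists>\<phi>. linear_functional \<phi> \<and> \<phi> b \<noteq> 0 \<and>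
      (\<forall>b'\<in>right_words \<union> (swapped_words \<union> words). b' \<noteq> b \<longrightarrow> \<phi> b' = 0)"
  proof cases
    case (1 i j k)
    then show ?thesis
      by (intro exI[of _ "right_coeff3 i j k"])
        (auto simp: linear_functional_coeff coeff_word coeff_right_word det3)
  next
    case (2 i j k l)
    then show ?thesis
      by (intro exI[of _ "right_coeff4 i j k l"])
        (auto simp: linear_functional_coeff coeff_word coeff_right_word det4)
  qed
qed

section \<open>Spanning, and the listed sets\<close>

interpretation free_alg_char_0: variety_algebra_char_0 "scale_free_alg :: 'k::field_char_0 \<Rightarrow>
    ('x, 'k) free_alg \<Rightarrow> ('x, 'k) free_alg" "(*)"
  by (rule variety_algebra_char_0.intro) (rule free_alg.variety_algebra_axioms)

lemma abs_free_alg_monomial: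
  "abs_free_alg (Poly_Mapping.single s 1) = (eval_magma (*) gen s :: ('x, 'k::field) free_alg)"
proof (induction s)
  case (App s t)
  have "Poly_Mapping.single (App s t) (1 :: 'k) =
      nafree_mult (Poly_Mapping.single s 1) (Poly_Mapping.single t 1)"
    by (simp add: nafree_mult_def)
  with App show ?case
    by (simp flip: times_free_alg.abs_eq)
qed (simp add: gen_def)

lemma span_monomials:
  "free_alg.span (range (eval_magma (*) gen)) = (UNIV :: ('x, 'k::field) free_alg set)"
proof -
  have "v \<in> free_alg.span (range (eval_magma (*) gen))" for v :: "('x, 'k) free_alg"
  proof (induction v rule: free_alg.abs_induct)
    case (1 p)
    have sum: "abs_free_alg (sum g A) = (\<Sum>s\<in>A. abs_free_alg (g s))"
        for g :: "'x magma \<Rightarrow> ('x, 'k) nafree" and A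
      by (induction A rule: infinite_finite_induct)
        (simp_all add: zero_free_alg.abs_eq flip: plus_free_alg.abs_eq)
    have "abs_free_alg p = (\<Sum>s\<in>Poly_Mapping.keys p.
        scale_free_alg (Poly_Mapping.lookup p s) (eval_magma (*) gen s))"
      by (subst nafree.nafree_expand[of p]) (simp add: sum abs_free_alg_monomial flip:
          scale_free_alg.abs_eq)
    also have "\<dots> \<in> free_alg.span (range (eval_magma (*) gen))"
      by (intro free_alg.span_sum free_alg.span_scale free_alg.span_base rangeI)
    finally show ?case .
  qed
  then show ?thesis by auto
qed

lemma span_basis:
  "free_alg.span (right_words \<union> (swapped_words \<union> words)) = (UNIV ::
      (nat, 'k::field_char_0) free_alg set)"
proof -
  let ?B = "right_words \<union> (swapped_words \<union> words) :: (nat, 'k) free_alg set"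
  have "eval_magma (*) gen m \<in> free_alg.span ?B" for m
  proof (rule free_alg_char_0.eval_in_subspace[OF free_alg.subspace_span])
    show "foldl (*) (gen i) (map gen js) \<in> free_alg.span ?B" if "sorted js" for i js
    proof (rule free_alg.span_base)
      have "word i js \<in> ?B" using that by blast
      then show "foldl (*) (gen i) (map gen js) \<in> ?B"
        by (simp only: word_def left_normed_def)
    qed
    show "gen i * gen k * gen j \<in> free_alg.span ?B" if "i < j" "j < k" for i j k
      unfolding word_short(2)[symmetric, of i k j] using that by (intro free_alg.span_base) blast
    show "gen k * (gen i * gen j) \<in> free_alg.span ?B" if "i < j" "j < k" for i j k
      using that by (intro free_alg.span_base) blast
    show "gen i * gen j * gen l * gen k \<in> free_alg.span ?B" if "i < j" "j < k" "k < l" for i j k l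
      unfolding word_short(3)[symmetric, of i j l k] using that by (intro free_alg.span_base) blast
    show "gen k * (gen i * gen j) * gen l \<in> free_alg.span ?B" if "i < j" "j < k" "k < l" for i j k l
      using that by (intro free_alg.span_base) blast
  qed
  then have "range (eval_magma (*) gen) \<subseteq> free_alg.span ?B"
    by auto
  then have "free_alg.span (range (eval_magma (*) gen)) \<subseteq> free_alg.span ?B"
    by (rule free_alg.span_minimal) (rule free_alg.subspace_span)
  then show ?thesis
    by (simp add: span_monomials top_unique)
qed

text \<open>If two indices coincide, the alternating functions vanish and the exceptional words are not new.\<close>

lemma ties3:
  fixes i j k :: nat
  assumes "i \<le> j" "j \<le> k" "\<not> (i < j \<and> j < k)"
  shows "(gen i * gen k * gen j :: (nat, 'k::field_char_0) free_alg) = word i [j, k]"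
    and "(gen k * (gen i * gen j) :: (nat, 'k) free_alg) = word k [i, j]"
proof -
  have tie: "i = j \<or> j = k" using assms by auto
  have "free_alg_char_0.tail_swap (gen i :: (nat, 'k) free_alg) (gen j) (gen k) = 0"
    using tie free_alg_char_0.alt3_repeat[OF free_alg_char_0.alt3_tail_swap] by auto
  then show "(gen i * gen k * gen j :: (nat, 'k) free_alg) = word i [j, k]"
    by (simp add: free_alg_char_0.tail_swap_def word_short)
  have "associator (*) (gen i :: (nat, 'k) free_alg) (gen j) (gen k) = 0"
    using tie free_alg_char_0.alt3_repeat[OF free_alg_char_0.alt3_A] by auto
  then have "associator (*) (gen k :: (nat, 'k) free_alg) (gen i) (gen j) = 0"
    by (simp only: free_alg_char_0.A_cyclic[of "gen k"])
  then show "(gen k * (gen i * gen j) :: (nat, 'k) free_alg) = word k [i, j]"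
    by (simp add: associator_def word_short)
qed

lemma ties4:
  fixes i j k l :: nat
  assumes "i \<le> j" "j \<le> k" "k \<le> l" "\<not> (i < j \<and> j < k \<and> k < l)"
  shows "(gen i * gen j * gen l * gen k :: (nat, 'k::field_char_0) free_alg) = word i [j, k, l]"
    and "(gen k * (gen i * gen j) * gen l :: (nat, 'k) free_alg) = word k [i, j, l]"
proof -
  have tie: "i = j \<or> j = k \<or> k = l" using assms by auto
  have "free_alg_char_0.tail_swap (gen i * gen j :: (nat, 'k) free_alg) (gen k) (gen l) = 0"
    using tie free_alg_char_0.alt4_repeat[OF free_alg_char_0.alt4_tail_swap_product] by auto
  then show "(gen i * gen j * gen l * gen k :: (nat, 'k) free_alg) = word i [j, k, l]"
    by (simp add: free_alg_char_0.tail_swap_def word_short)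
  have "free_alg_char_0.right_assoc (gen i :: (nat, 'k) free_alg) (gen j) (gen k) (gen l) = 0"
    using tie free_alg_char_0.alt4_repeat[OF free_alg_char_0.alt4_right_assoc] by auto
  then have "associator (*) (gen k :: (nat, 'k) free_alg) (gen i) (gen j) * gen l = 0"
    by (simp only: free_alg_char_0.A_cyclic[of "gen k"] free_alg_char_0.right_assoc_def)
  then show "(gen k * (gen i * gen j) * gen l :: (nat, 'k) free_alg) = word k [i, j, l]"
    by (simp add: associator_def word_short free_alg_char_0.mult_diff_left)
qed

lemma word_in_basis_set:
  assumes "sorted bs"
  shows "(word a bs :: (nat, 'k::field) free_alg) \<in> basis_set (Suc (length bs))"
proof (cases bs rule: word_length_cases)
  case (1 b)
  then show ?thesis by (auto simp: basis_set_def basis2_def word_short)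
next
  case (2 b c)
  then have "b \<le> c" using assms by simp
  then consider "a \<le> b" | "b \<le> a" "a \<le> c" | "c \<le> a" by linarith
  then have "(word a bs :: (nat, 'k) free_alg) \<in> basis3"
    unfolding 2 word_short basis3_def using \<open>b \<le> c\<close> by cases blast+
  then show ?thesis using 2 by (simp add: basis_set_def)
next
  case (3 b c d)
  then have s: "b \<le> c" "c \<le> d" using assms by simp_all
  then consider "a \<le> b" | "b \<le> a" "a \<le> c" | "c \<le> a" "a \<le> d" | "d \<le> a" by linarith
  then have "(word a bs :: (nat, 'k) free_alg) \<in> basis4"
    unfolding 3 word_short basis4_def using s by cases blast+
  then show ?thesis using 3 by (simp add: basis_set_def)
next
  case 4
  then show ?thesis by (auto simp: basis_set_def basis1_def word_simps)
next
  case 5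
  then show ?thesis using assms by (auto simp: basis_set_def basis_long_def word_def)
qed

text \<open>A tail \<open>j \<le> k\<close> and a head in arbitrary position relative to it amount to one of the three
  listed products of three generators, and similarly in degree four; all listed elements that are
  not of this form are exceptional words, or become left-normed because of a tie.\<close>

lemma Union_basis_set:
  "(\<Union>n\<in>{1..}. basis_set n) = (right_words \<union> (swapped_words \<union> words) ::
      (nat, 'k::field_char_0) free_alg set)"
  (is "?L = ?R")
proof -
  define R where "R = ?R"
  have W: "word a bs \<in> R" if "sorted bs" for a bs
    using that unfolding R_def by blast
  have S3: "gen i * gen k * gen j \<in> R" and R3: "gen k * (gen i * gen j) \<in> R" if "i < j" "j < k"
      for i j k
  proof -
    have "word i [k, j] \<in> R"
      using that unfolding R_def by blast
    then show "gen i * gen k * gen j \<in> R"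
      by (simp only: word_short)
    show "gen k * (gen i * gen j) \<in> R"
      using that unfolding R_def by blast
  qed
  have S4: "gen i * gen j * gen l * gen k \<in> R" and R4: "gen k * (gen i * gen j) * gen l \<in> R"
    if "i < j" "j < k" "k < l" for i j k l
  proof -
    have "word i [j, l, k] \<in> R"
      using that unfolding R_def by blast
    then show "gen i * gen j * gen l * gen k \<in> R"
      by (simp only: word_short)
    show "gen k * (gen i * gen j) * gen l \<in> R"
      using that unfolding R_def by blast
  qed
  have le3: "gen i * gen k * gen j \<in> R" "gen k * (gen i * gen j) \<in> R" if "i \<le> j" "j \<le> k" for i j k
  proof -
    have "word i [j, k] \<in> R" "word k [i, j] \<in> R"
      using that by (simp_all add: W)
    then show "gen i * gen k * gen j \<in> R" "gen k * (gen i * gen j) \<in> R"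
      by (cases "i < j \<and> j < k"; simp add: S3 R3 ties3[OF that])+
  qed
  have le4: "gen i * gen j * gen l * gen k \<in> R" "gen k * (gen i * gen j) * gen l \<in> R"
    if "i \<le> j" "j \<le> k" "k \<le> l" for i j k l
  proof -
    have "word i [j, k, l] \<in> R" "word k [i, j, l] \<in> R"
      using that by (simp_all add: W)
    then show "gen i * gen j * gen l * gen k \<in> R" "gen k * (gen i * gen j) * gen l \<in> R"
      by (cases "i < j \<and> j < k \<and> k < l"; simp add: S4 R4 ties4[OF that])+
  qed
  have w2: "gen a * gen b * gen c \<in> R" if "b \<le> c" for a b c
    using W[of "[b, c]" a] that by (simp add: word_short)
  have w3: "gen a * gen b * gen c * gen d \<in> R" if "b \<le> c" "c \<le> d" for a b c d
    using W[of "[b, c, d]" a] that by (simp add: word_short)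
  have "basis1 \<subseteq> R"
    using W[of "[]"] by (auto simp: basis1_def word_simps)
  moreover have "basis2 \<subseteq> R"
    using W[of "[_]"] by (auto simp: basis2_def word_short)
  moreover have "basis3 \<subseteq> R"
    unfolding basis3_def by (auto intro: w2 le3)
  moreover have "basis4 \<subseteq> R"
    unfolding basis4_def by (auto intro: w3 le4)
  moreover have "basis_long n \<subseteq> R" for n
    using W by (auto simp: basis_long_def word_def)
  ultimately have "basis_set n \<subseteq> R" for n
    by (simp add: basis_set_def)
  then have "?L \<subseteq> R"
    by blast
  moreover have "R \<subseteq> ?L"
  proof -
    have mem: "v \<in> ?L" if "v \<in> basis_set (Suc n)" for v n
      using that by auto
    have a: "word a bs \<in> ?L" if "sorted bs" for a bs
      using word_in_basis_set[OF that] by (rule mem)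
    have b: "word i [k, j] \<in> ?L" "gen k * (gen i * gen j) \<in> ?L" if "i < j" "j < k" for i j k
    proof -
      have "word i [k, j] \<in> basis3" "gen k * (gen i * gen j) \<in> basis3"
        unfolding word_short basis3_def using less_imp_le[OF that(1)] less_imp_le[OF that(2)] by blast+
      then show "word i [k, j] \<in> ?L" "gen k * (gen i * gen j) \<in> ?L"
        by (intro mem[of _ 2]; simp add: basis_set_def)+
    qed
    have c: "word i [j, l, k] \<in> ?L" "gen k * (gen i * gen j) * gen l \<in> ?L"
      if "i < j" "j < k" "k < l" for i j k l
    proof -
      have "word i [j, l, k] \<in> basis4" "gen k * (gen i * gen j) * gen l \<in> basis4"
        unfolding word_short basis4_def using that[THEN less_imp_le] by blast+
      then show "word i [j, l, k] \<in> ?L" "gen k * (gen i * gen j) * gen l \<in> ?L"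
        by (intro mem[of _ 3]; simp add: basis_set_def)+
    qed
    show ?thesis
      unfolding R_def by (intro Un_least subsetI; elim CollectE exE conjE; simp only: a b c)
  qed
  ultimately show ?thesis
    unfolding R_def by (rule subset_antisym)
qed

theorem theorem4:
  shows "is_basis (scale_free_alg :: 'k::field_char_0 \<Rightarrow> (nat, 'k) free_alg \<Rightarrow> (nat, 'k) free_alg)
    (\<Union>n\<in>{1..}. basis_set n)"
  unfolding is_basis_def Union_basis_set
  using independent_right_words span_basis by (rule conjI)

end
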